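(* Let $(M,J)$ be a $4$-dimensional almost complex manifold and let $x\in M$. Assume that there exists an almost complex blow-up of $(M,J)$ at $x$. Then the Nijenhuis tensor of $J$ vanishes at $x$.
   Context: An almost complex structure on a smooth manifold $M$ is a smooth $J\in\mathrm{End}(TM)$ with $J^2=-\mathrm{id}$. A smooth map $f:(M,J)\to(M',J')$ is pseudoholomorphic if $J'\circ df=df\circ J$. The Nijenhuis tensor of $J$ is $N_J(X,Y)=[JX,JY]-[X,Y]-J[JX,Y]-J[X,JY]$ for vector fields $X,Y$. Almost complex blow-up. Let $(M,J)$ be $4$-dimensional, $x\in M$, and let $(\mathcal{U},\phi)$ be a smooth local chart at $x$ with $0\in\mathcal{U}\subset\mathbb{C}^2$, $\phi:\mathcal{U}\to\phi(\mathcal{U})\subset M$, $\phi(0)=x$. Let $\mathcal{B}=\{((z_1,z_2),[v_1:v_2])\in\mathcal{U}\times\mathbb{P}^{1}(\mathbb{C}) : z_1v_2-z_2v_1=0\}$. Let $\tilde{M}_x$ be the smooth manifold $((M\setminus\{x\})\cup\mathcal{B})/\sim$, where $\phi(z_1,z_2)\sim((z_1,z_2),[z_1:z_2])$ for $(z_1,z_2)\neq(0,0)$, and let $\pi:\tilde{M}_x\to M$ be $\pi((z_1,z_2),[v_1:v_2])=\phi(z_1,z_2)$ on $\mathcal{B}$ and $\pi(y)=y$ for $y\in M\setminus\{x\}$. An almost complex blow-up of $M$ at $x$ with respect to $(\mathcal{U},\phi)$ is a smooth almost complex structure $\tilde{J}$ on $\tilde{M}_x$ such that $\pi$ is $(\tilde{J},J)$-pseudoholomorphic.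 An almost complex blow-up of $(M,J)$ at $x$ is one with respect to some smooth local chart at $x$. *)

theory Defs
  imports "HOL-Analysis.Analysis"
begin

section \<open>Smooth maps between normed spaces\<close>

primrec Ck_on :: "nat \<Rightarrow> ('e::real_normed_vector \<Rightarrow> 'f::real_normed_vector) \<Rightarrow> 'e set \<Rightarrow> bool" where
  "Ck_on 0 f S \<longleftrightarrow> continuous_on S f"
| "Ck_on (Suc n) f S \<longleftrightarrow> (\<forall>z\<in>S. f differentiable (at z)) \<and>
     (\<forall>v. Ck_on n (\<lambda>z. frechet_derivative f (at z) v) S)"

text \<open>Only used for open \<open>S\<close> in finite-dimensional spaces, where it is the usual \<open>C\<^sup>\<infinity>\<close>.\<close>

definition smooth_on :: "('e::real_normed_vector \<Rightarrow> 'f::real_normed_vector) \<Rightarrow> 'e set \<Rightarrow> bool" where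
  "smooth_on f S \<longleftrightarrow> (\<forall>n. Ck_on n f S)"


section \<open>Smooth manifolds\<close>

text \<open>A manifold is given by an atlas; its underlying set is the union of the chart domains, and
  its topology is the one for which the charts are homeomorphisms onto open sets. The values of
  \<open>coord k\<close> outside \<open>domain k\<close> are irrelevant.\<close>

datatype ('a, 'e) chart = Chart (domain: "'a set") (coord: "'a \<Rightarrow> 'e")

definition inv_coord :: "('a, 'e) chart \<Rightarrow> 'e \<Rightarrow> 'a" where
  "inv_coord k = inv_into (domain k) (coord k)"

definition chart_of_param :: "'e set \<Rightarrow> ('e \<Rightarrow> 'a) \<Rightarrow> ('a, 'e) chart" where
  "chart_of_param V \<psi> = Chart (\<psi> ` V) (inv_into V \<psi>)"

definition is_chart :: "('a, 'e::topological_space) chart \<Rightarrow> bool" where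
  "is_chart k \<longleftrightarrow> inj_on (coord k) (domain k) \<and> open (coord k ` domain k)"

definition smooth_transition :: "('a, 'e::real_normed_vector) chart \<Rightarrow> ('a, 'e) chart \<Rightarrow> bool" where
  "smooth_transition k k' \<longleftrightarrow>
     open (coord k ` (domain k \<inter> domain k')) \<and>
     smooth_on (\<lambda>z. coord k' (inv_coord k z)) (coord k ` (domain k \<inter> domain k'))"

definition smooth_atlas :: "('a, 'e::real_normed_vector) chart set \<Rightarrow> bool" where
  "smooth_atlas A \<longleftrightarrow> (\<forall>k\<in>A. is_chart k) \<and> (\<forall>k\<in>A. \<forall>k'\<in>A. smooth_transition k k')"

definition points :: "('a, 'e) chart set \<Rightarrow> 'a set" where
  "points A = (\<Union>k\<in>A. domain k)"

definition manifold_topology :: "('a, 'e::topological_space) chart set \<Rightarrow> 'a topology" where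
  "manifold_topology A =
     topology (\<lambda>W. W \<subseteq> points A \<and> (\<forall>k\<in>A. open (coord k ` (W \<inter> domain k))))"

lemma openin_manifold_topology:
  fixes A :: "('a, 'e::topological_space) chart set"
  assumes "\<forall>k\<in>A. is_chart k"
  shows "openin (manifold_topology A) W \<longleftrightarrow>
           W \<subseteq> points A \<and> (\<forall>k\<in>A. open (coord k ` (W \<inter> domain k)))"
proof -
  let ?L = "\<lambda>W. W \<subseteq> points A \<and> (\<forall>k\<in>A. open (coord k ` (W \<inter> domain k)))"
  have "istopology ?L"
    unfolding istopology_def
  proof (intro conjI allI impI)
    fix S T assume S: "?L S" and T: "?L T"
    then show "S \<inter> T \<subseteq> points A" by auto
    show "\<forall>k\<in>A. open (coord k ` (S \<inter> T \<inter> domain k))"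
    proof
      fix k assume k: "k \<in> A"
      then have "inj_on (coord k) (domain k)" using assms by (auto simp: is_chart_def)
      then have "coord k ` (S \<inter> T \<inter> domain k) =
          coord k ` (S \<inter> domain k) \<inter> coord k ` (T \<inter> domain k)"
        by (auto simp: inj_on_def image_iff)
      then show "open (coord k ` (S \<inter> T \<inter> domain k))" using S T k by auto
    qed
  next
    fix \<K> assume K: "\<forall>S\<in>\<K>. ?L S"
    then show "\<Union>\<K> \<subseteq> points A" by auto
    show "\<forall>k\<in>A. open (coord k ` (\<Union>\<K> \<inter> domain k))"
    proof
      fix k assume "k \<in> A"
      moreover have "coord k ` (\<Union>\<K> \<inter> domain k) = (\<Union>S\<in>\<K>. coord k ` (S \<inter> domain k))" by auto
      ultimately show "open (coord k ` (\<Union>\<K> \<inter> domain k))" using K by auto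
    qed
  qed
  then show ?thesis by (simp add: manifold_topology_def topology_inverse')
qed

definition smooth_manifold :: "('a, 'e::euclidean_space) chart set \<Rightarrow> bool" where
  "smooth_manifold A \<longleftrightarrow> smooth_atlas A \<and>
     Hausdorff_space (manifold_topology A) \<and> second_countable (manifold_topology A)"

definition smooth_map ::
  "('a, 'e::real_normed_vector) chart set \<Rightarrow> ('b, 'f::real_normed_vector) chart set \<Rightarrow> ('a \<Rightarrow> 'b) \<Rightarrow> bool"
where
  "smooth_map A B f \<longleftrightarrow> f ` points A \<subseteq> points B \<and>
     (\<forall>k\<in>A. \<forall>k'\<in>B.
        open (coord k ` (domain k \<inter> f -` domain k')) \<and>
        smooth_on (\<lambda>z. coord k' (f (inv_coord k z))) (coord k ` (domain k \<inter> f -` domain k')))"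


section \<open>Tangent vectors, differentials, vector fields\<close>

text \<open>A tangent vector at \<open>p\<close> is the family of its components in all charts of the atlas around
  \<open>p\<close>, related by the differentials of the coordinate changes, and \<open>0\<close> at all other indices.
  The vector space operations are pointwise.\<close>

type_synonym ('a, 'e) tvec = "('a, 'e) chart \<Rightarrow> 'e"

definition charts_at :: "('a, 'e) chart set \<Rightarrow> 'a \<Rightarrow> ('a, 'e) chart set" where
  "charts_at A p = {k\<in>A. p \<in> domain k}"

definition coord_diff ::
  "('a, 'e::real_normed_vector) chart \<Rightarrow> ('b, 'f::real_normed_vector) chart \<Rightarrow> ('a \<Rightarrow> 'b) \<Rightarrow> 'a \<Rightarrow> 'e \<Rightarrow> 'f"
where
  "coord_diff k k' f p = frechet_derivative (\<lambda>z. coord k' (f (inv_coord k z))) (at (coord k p))"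

definition tangent_space :: "('a, 'e::real_normed_vector) chart set \<Rightarrow> 'a \<Rightarrow> ('a, 'e) tvec set" where
  "tangent_space A p =
     {v. (\<forall>k\<in>charts_at A p. \<forall>k'\<in>charts_at A p. v k' = coord_diff k k' (\<lambda>q. q) p (v k)) \<and>
         (\<forall>k. k \<notin> charts_at A p \<longrightarrow> v k = 0)}"

text \<open>The tangent vector at \<open>p\<close> with components \<open>e\<close> in the chart \<open>k\<close>.\<close>

definition tvec_of :: "('a, 'e::real_normed_vector) chart set \<Rightarrow> ('a, 'e) chart \<Rightarrow> 'a \<Rightarrow> 'e \<Rightarrow> ('a, 'e) tvec" where
  "tvec_of A k p e = (\<lambda>k'. if k' \<in> charts_at A p then coord_diff k k' (\<lambda>q. q) p e else 0)"

text \<open>For smooth \<open>f\<close> the choice of the chart \<open>k\<close> is immaterial, by the chain rule.\<close>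

definition differential ::
  "('a, 'e::real_normed_vector) chart set \<Rightarrow> ('b, 'f::real_normed_vector) chart set \<Rightarrow> ('a \<Rightarrow> 'b) \<Rightarrow>
   'a \<Rightarrow> ('a, 'e) tvec \<Rightarrow> ('b, 'f) tvec"
where
  "differential A B f p v =
     (let k = (SOME k. k \<in> charts_at A p) in
      (\<lambda>k'. if k' \<in> charts_at B (f p) then coord_diff k k' f p (v k) else 0))"

definition smooth_vector_field ::
  "('a, 'e::real_normed_vector) chart set \<Rightarrow> ('a \<Rightarrow> ('a, 'e) tvec) \<Rightarrow> bool" where
  "smooth_vector_field A X \<longleftrightarrow> (\<forall>p\<in>points A. X p \<in> tangent_space A p) \<and>
     (\<forall>k\<in>A. smooth_on (\<lambda>z. X (inv_coord k z) k) (coord k ` domain k))"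

text \<open>In coordinates \<open>[X, Y] = DY(X) - DX(Y)\<close>, i.e. \<open>[X, Y] f = X (Y f) - Y (X f)\<close> on functions.\<close>

definition lie_bracket ::
  "('a, 'e::real_normed_vector) chart set \<Rightarrow> ('a \<Rightarrow> ('a, 'e) tvec) \<Rightarrow> ('a \<Rightarrow> ('a, 'e) tvec) \<Rightarrow>
   'a \<Rightarrow> ('a, 'e) tvec"
where
  "lie_bracket A X Y p = (\<lambda>k. if k \<in> charts_at A p
     then frechet_derivative (\<lambda>z. Y (inv_coord k z) k) (at (coord k p)) (X p k)
        - frechet_derivative (\<lambda>z. X (inv_coord k z) k) (at (coord k p)) (Y p k)
     else 0)"


section \<open>Almost complex structures\<close>

text \<open>Smoothness of \<open>J\<close> means smoothness of its matrix entries in every chart.\<close>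

definition smooth_endomorphism ::
  "('a, 'e::real_normed_vector) chart set \<Rightarrow> ('a \<Rightarrow> ('a, 'e) tvec \<Rightarrow> ('a, 'e) tvec) \<Rightarrow> bool" where
  "smooth_endomorphism A J \<longleftrightarrow>
     (\<forall>p\<in>points A. \<forall>v\<in>tangent_space A p.
        J p v \<in> tangent_space A p \<and>
        (\<forall>c. J p (\<lambda>k. c *\<^sub>R v k) = (\<lambda>k. c *\<^sub>R J p v k)) \<and>
        (\<forall>w\<in>tangent_space A p. J p (\<lambda>k. v k + w k) = (\<lambda>k. J p v k + J p w k))) \<and>
     (\<forall>k\<in>A. \<forall>e. smooth_on (\<lambda>z. J (inv_coord k z) (tvec_of A k (inv_coord k z) e) k)
                          (coord k ` domain k))"

definition almost_complex_structure ::
  "('a, 'e::real_normed_vector) chart set \<Rightarrow> ('a \<Rightarrow> ('a, 'e) tvec \<Rightarrow> ('a, 'e) tvec) \<Rightarrow> bool" where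
  "almost_complex_structure A J \<longleftrightarrow> smooth_endomorphism A J \<and>
     (\<forall>p\<in>points A. \<forall>v\<in>tangent_space A p. J p (J p v) = (\<lambda>k. - v k))"

definition pseudoholomorphic ::
  "('a, 'e::real_normed_vector) chart set \<Rightarrow> ('a \<Rightarrow> ('a, 'e) tvec \<Rightarrow> ('a, 'e) tvec) \<Rightarrow>
   ('b, 'f::real_normed_vector) chart set \<Rightarrow> ('b \<Rightarrow> ('b, 'f) tvec \<Rightarrow> ('b, 'f) tvec) \<Rightarrow>
   ('a \<Rightarrow> 'b) \<Rightarrow> bool"
where
  "pseudoholomorphic A J A' J' f \<longleftrightarrow> smooth_map A A' f \<and>
     (\<forall>p\<in>points A. \<forall>v\<in>tangent_space A p.
        J' (f p) (differential A A' f p v) = differential A A' f p (J p v))"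

definition nijenhuis ::
  "('a, 'e::real_normed_vector) chart set \<Rightarrow> ('a \<Rightarrow> ('a, 'e) tvec \<Rightarrow> ('a, 'e) tvec) \<Rightarrow>
   ('a \<Rightarrow> ('a, 'e) tvec) \<Rightarrow> ('a \<Rightarrow> ('a, 'e) tvec) \<Rightarrow> 'a \<Rightarrow> ('a, 'e) tvec"
where
  "nijenhuis A J X Y p =
     (let JX = (\<lambda>q. J q (X q)); JY = (\<lambda>q. J q (Y q)) in
      (\<lambda>k. lie_bracket A JX JY p k - lie_bracket A X Y p k
         - J p (lie_bracket A JX Y p) k - J p (lie_bracket A X JY p) k))"


section \<open>The almost complex blow-up\<close>

text \<open>Four-dimensional manifolds are modelled on \<open>\<complex>\<^sup>2\<close>, regarded as a real normed space; no
  complex structure of \<open>\<complex>\<^sup>2\<close> enters the preceding sections.\<close>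

type_synonym C2 = "complex \<times> complex"

lemma DIM_C2: "DIM(C2) = 4"
  by simp

text \<open>The smooth local charts \<open>(U, \<phi>)\<close> at \<open>x\<close>, where \<open>\<phi>\<close> goes from \<open>U\<close> to the manifold; they need
  not belong to the atlas \<open>A\<close>, but are compatible with it.\<close>

definition local_chart_at :: "('a, C2) chart set \<Rightarrow> 'a \<Rightarrow> C2 set \<Rightarrow> (C2 \<Rightarrow> 'a) \<Rightarrow> bool" where
  "local_chart_at A x U \<phi> \<longleftrightarrow>
     open U \<and> 0 \<in> U \<and> inj_on \<phi> U \<and> \<phi> ` U \<subseteq> points A \<and> \<phi> 0 = x \<and>
     (\<forall>k\<in>A. smooth_transition (chart_of_param U \<phi>) k \<and> smooth_transition k (chart_of_param U \<phi>))"

text \<open>A point \<open>[v\<^sub>1 : v\<^sub>2]\<close> of the complex projective line is a complex line in \<open>\<complex>\<^sup>2\<close>.\<close>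

definition complex_line :: "C2 \<Rightarrow> C2 set" where
  "complex_line v = range (\<lambda>c. (c * fst v, c * snd v))"

definition local_blowup :: "C2 set \<Rightarrow> (C2 \<times> C2 set) set" where
  "local_blowup U =
     {((z1, z2), complex_line (v1, v2)) | z1 z2 v1 v2.
        (z1, z2) \<in> U \<and> (v1, v2) \<noteq> (0, 0) \<and> z1 * v2 - z2 * v1 = 0}"

definition blowup_sum :: "('a, C2) chart set \<Rightarrow> 'a \<Rightarrow> C2 set \<Rightarrow> ('a + C2 \<times> C2 set) set" where
  "blowup_sum A x U = Inl ` (points A - {x}) \<union> Inr ` local_blowup U"

definition blowup_glue :: "C2 set \<Rightarrow> (C2 \<Rightarrow> 'a) \<Rightarrow> ('a + C2 \<times> C2 set) rel" where
  "blowup_glue U \<phi> = {(Inl (\<phi> z), Inr (z, complex_line z)) | z. z \<in> U \<and> z \<noteq> 0}"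

definition blowup_rel ::
  "('a, C2) chart set \<Rightarrow> 'a \<Rightarrow> C2 set \<Rightarrow> (C2 \<Rightarrow> 'a) \<Rightarrow> ('a + C2 \<times> C2 set) rel" where
  "blowup_rel A x U \<phi> = Id_on (blowup_sum A x U) \<union> blowup_glue U \<phi> \<union> (blowup_glue U \<phi>)\<inverse>"

lemma equiv_blowup_rel:
  assumes "local_chart_at A x U \<phi>"
  shows "equiv (blowup_sum A x U) (blowup_rel A x U \<phi>)"
proof -
  have inj: "inj_on \<phi> U" and 0: "0 \<in> U" and x: "\<phi> 0 = x" and sub: "\<phi> ` U \<subseteq> points A"
    using assms by (auto simp: local_chart_at_def)
  have glue: "blowup_glue U \<phi> \<subseteq> blowup_sum A x U \<times> blowup_sum A x U"
  proof
    fix r assume "r \<in> blowup_glue U \<phi>"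
    then obtain z where r: "r = (Inl (\<phi> z), Inr (z, complex_line z))" and z: "z \<in> U" "z \<noteq> 0"
      by (auto simp: blowup_glue_def)
    have "\<phi> z \<noteq> x" using inj 0 x z by (metis inj_onD)
    then have 1: "Inl (\<phi> z) \<in> blowup_sum A x U" using z sub by (auto simp: blowup_sum_def)
    obtain z1 z2 where zz: "z = (z1, z2)" by (cases z)
    have "(z, complex_line z) \<in> local_blowup U"
      unfolding local_blowup_def zz mem_Collect_eq
      apply (rule exI[of _ z1], rule exI[of _ z2], rule exI[of _ z1], rule exI[of _ z2])
      using z by (simp add: zz zero_prod_def)
    then have "Inr (z, complex_line z) \<in> blowup_sum A x U" by (simp add: blowup_sum_def)
    with 1 show "r \<in> blowup_sum A x U \<times> blowup_sum A x U" by (simp add: r)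
  qed
  show ?thesis
  proof (rule equivI)
    show "blowup_rel A x U \<phi> \<subseteq> blowup_sum A x U \<times> blowup_sum A x U"
      using glue by (auto simp: blowup_rel_def)
    show "refl_on (blowup_sum A x U) (blowup_rel A x U \<phi>)"
      by (auto simp: refl_on_def blowup_rel_def)
    show "sym (blowup_rel A x U \<phi>)"
      by (auto simp: sym_def blowup_rel_def)
    have uniq: "p = p'" if "(p, r) \<in> blowup_glue U \<phi>" "(p', r) \<in> blowup_glue U \<phi>" for p p' r
      using that by (auto simp: blowup_glue_def)
    have uniq': "r = r'" if "(p, r) \<in> blowup_glue U \<phi>" "(p, r') \<in> blowup_glue U \<phi>" for p r r'
      using that inj by (auto simp: blowup_glue_def dest: inj_onD)
    have disj: False if "(p, r) \<in> blowup_glue U \<phi>" "(r, s) \<in> blowup_glue U \<phi>" for p r s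
      using that by (auto simp: blowup_glue_def)
    show "trans (blowup_rel A x U \<phi>)"
    proof (rule transI)
      fix p q r assume "(p, q) \<in> blowup_rel A x U \<phi>" "(q, r) \<in> blowup_rel A x U \<phi>"
      then show "(p, r) \<in> blowup_rel A x U \<phi>"
        unfolding blowup_rel_def using uniq uniq' disj glue by fast
    qed
  qed
qed

definition blowup_points ::
  "('a, C2) chart set \<Rightarrow> 'a \<Rightarrow> C2 set \<Rightarrow> (C2 \<Rightarrow> 'a) \<Rightarrow> ('a + C2 \<times> C2 set) set set" where
  "blowup_points A x U \<phi> = blowup_sum A x U // blowup_rel A x U \<phi>"

definition blowup_class ::
  "('a, C2) chart set \<Rightarrow> 'a \<Rightarrow> C2 set \<Rightarrow> (C2 \<Rightarrow> 'a) \<Rightarrow> 'a + C2 \<times> C2 set \<Rightarrow> ('a + C2 \<times> C2 set) set" where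
  "blowup_class A x U \<phi> r = blowup_rel A x U \<phi> `` {r}"

definition blowup_proj :: "(C2 \<Rightarrow> 'a) \<Rightarrow> ('a + C2 \<times> C2 set) set \<Rightarrow> 'a" where
  "blowup_proj \<phi> q = the_elem (case_sum (\<lambda>y. y) (\<lambda>(z, l). \<phi> z) ` q)"

text \<open>The smooth structure of the blow-up: the charts of \<open>A\<close> restricted to the complement of \<open>x\<close>,
  and the two standard charts \<open>((a, a u), [1 : u]) \<mapsto> (a, u)\<close> and \<open>((u b, b), [u : 1]) \<mapsto> (u, b)\<close> of
  the local blow-up.\<close>

definition blowup_atlas ::
  "('a, C2) chart set \<Rightarrow> 'a \<Rightarrow> C2 set \<Rightarrow> (C2 \<Rightarrow> 'a) \<Rightarrow> (('a + C2 \<times> C2 set) set, C2) chart set" where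
  "blowup_atlas A x U \<phi> =
     (\<lambda>k. Chart ((\<lambda>y. blowup_class A x U \<phi> (Inl y)) ` (domain k - {x}))
                (\<lambda>q. coord k (blowup_proj \<phi> q))) ` A \<union>
     {chart_of_param {(a, u). (a, a * u) \<in> U}
        (\<lambda>(a, u). blowup_class A x U \<phi> (Inr ((a, a * u), complex_line (1, u)))),
      chart_of_param {(u, b). (u * b, b) \<in> U}
        (\<lambda>(u, b). blowup_class A x U \<phi> (Inr ((u * b, b), complex_line (u, 1))))}"

lemma complex_line_scale:
  assumes "c \<noteq> 0"
  shows "complex_line (c * v1, c * v2) = complex_line (v1, v2)"
proof -
  have "(d * v1, d * v2) \<in> complex_line (c * v1, c * v2)" for d
    unfolding complex_line_def using assms
    by (intro image_eqI[of _ _ "d / c"]) auto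
  then show ?thesis by (auto simp: complex_line_def mult.assoc[symmetric])
qed

lemma local_blowup_alt:
  "local_blowup U =
     {((a, a * u), complex_line (1, u)) | a u. (a, a * u) \<in> U} \<union>
     {((u * b, b), complex_line (u, 1)) | u b. (u * b, b) \<in> U}" (is "_ = ?R")
proof
  show "local_blowup U \<subseteq> ?R"
  proof
    fix r assume "r \<in> local_blowup U"
    then obtain z1 z2 v1 v2 where r: "r = ((z1, z2), complex_line (v1, v2))"
      and z: "(z1, z2) \<in> U" and v: "v1 \<noteq> 0 \<or> v2 \<noteq> 0" and eq: "z1 * v2 = z2 * v1"
      by (auto simp: local_blowup_def)
    show "r \<in> ?R"
    proof (cases "v1 = 0")
      case False
      then have "z2 = z1 * (v2 / v1)" using eq by (simp add: field_simps)
      moreover have "complex_line (v1, v2) = complex_line (1, v2 / v1)"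
        using complex_line_scale[OF False, of 1 "v2 / v1"] False by simp
      ultimately show ?thesis using r z by blast
    next
      case True
      then have v2: "v2 \<noteq> 0" using v by simp
      then have "z1 = (v1 / v2) * z2" using eq by (simp add: field_simps)
      moreover have "complex_line (v1, v2) = complex_line (v1 / v2, 1)"
        using complex_line_scale[OF v2, of "v1 / v2" 1] v2 by simp
      ultimately show ?thesis using r z by blast
    qed
  qed
  show "?R \<subseteq> local_blowup U"
    by (fastforce simp: local_blowup_def)
qed

lemma points_blowup_atlas: "points (blowup_atlas A x U \<phi>) = blowup_points A x U \<phi>"
proof -
  have "points (blowup_atlas A x U \<phi>) =
      blowup_class A x U \<phi> ` (Inl ` (points A - {x}) \<union> Inr ` local_blowup U)"
    unfolding local_blowup_alt
    by (auto simp: points_def blowup_atlas_def chart_of_param_def image_iff; blast)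
  then show ?thesis
    by (auto simp: blowup_points_def blowup_sum_def quotient_def blowup_class_def)
qed

lemma blowup_proj_class:
  assumes "local_chart_at A x U \<phi>"
  shows "y \<in> points A - {x} \<Longrightarrow> blowup_proj \<phi> (blowup_class A x U \<phi> (Inl y)) = y"
    and "(z, l) \<in> local_blowup U \<Longrightarrow> blowup_proj \<phi> (blowup_class A x U \<phi> (Inr (z, l))) = \<phi> z"
proof -
  let ?f = "case_sum (\<lambda>y. y) (\<lambda>(z, l). \<phi> z)"
  have const: "?f ` blowup_class A x U \<phi> r = {?f r}" if "r \<in> blowup_sum A x U" for r
  proof -
    have "r \<in> blowup_class A x U \<phi> r"
      using that by (auto simp: blowup_class_def blowup_rel_def)
    moreover have "?f s = ?f r" if "s \<in> blowup_class A x U \<phi> r" for s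
      using that by (auto simp: blowup_class_def blowup_rel_def blowup_glue_def)
    ultimately show ?thesis by blast
  qed
  show "blowup_proj \<phi> (blowup_class A x U \<phi> (Inl y)) = y" if "y \<in> points A - {x}"
    using const[of "Inl y"] that by (simp add: blowup_proj_def blowup_sum_def)
  show "blowup_proj \<phi> (blowup_class A x U \<phi> (Inr (z, l))) = \<phi> z" if "(z, l) \<in> local_blowup U"
    using const[of "Inr (z, l)"] that by (simp add: blowup_proj_def blowup_sum_def)
qed

definition almost_complex_blowup_wrt ::
  "('a, C2) chart set \<Rightarrow> ('a \<Rightarrow> ('a, C2) tvec \<Rightarrow> ('a, C2) tvec) \<Rightarrow> 'a \<Rightarrow> C2 set \<Rightarrow> (C2 \<Rightarrow> 'a) \<Rightarrow>
   (('a + C2 \<times> C2 set) set \<Rightarrow> (('a + C2 \<times> C2 set) set, C2) tvec \<Rightarrow> (('a + C2 \<times> C2 set) set, C2) tvec) \<Rightarrow>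
   bool"
where
  "almost_complex_blowup_wrt A J x U \<phi> J' \<longleftrightarrow>
     almost_complex_structure (blowup_atlas A x U \<phi>) J' \<and>
     pseudoholomorphic (blowup_atlas A x U \<phi>) J' A J (blowup_proj \<phi>)"

definition has_almost_complex_blowup ::
  "('a, C2) chart set \<Rightarrow> ('a \<Rightarrow> ('a, C2) tvec \<Rightarrow> ('a, C2) tvec) \<Rightarrow> 'a \<Rightarrow> bool" where
  "has_almost_complex_blowup A J x \<longleftrightarrow>
     (\<exists>U \<phi> J'. local_chart_at A x U \<phi> \<and> almost_complex_blowup_wrt A J x U \<phi> J')"

end

theory Submission
  imports Defs
begin

text \<open>Read in the parametrization \<open>\<phi>\<close> of a neighbourhood of \<open>x\<close>, the structure is a family \<open>J(z)\<close> of real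
linear maps of \<open>\<complex>\<^sup>2\<close> with \<open>J(z)\<^sup>2 = -1\<close>; let \<open>L(h) = D\<^sub>h J\<close> at the origin. In the chart \<open>(a, u)\<close> of the
blow-up the projection is \<open>(a, u) \<mapsto> a v\<close> with \<open>v = (1, u)\<close>, and its differential sends \<open>(\<alpha>, \<beta>)\<close> to
\<open>\<alpha> v + (0, a \<beta>)\<close>. So the second component \<open>T\<close> of the lift of \<open>J\<close> applied to \<open>(\<alpha>, \<beta>)\<close> satisfies
\<open>t(J(a v)(\<alpha> v + (0, a \<beta>))) = a T(a, u)\<close>, where \<open>t(p, q) = q - u p\<close> is a coordinate transversal to the
line through \<open>v\<close>. The whole theorem is what divisibility by \<open>a\<close>, with a quotient differentiable at
\<open>a = 0\<close>, says about \<open>J(0)\<close> and \<open>L\<close>.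

\<^item> At \<open>a = 0\<close>: \<open>J(0)\<close> preserves every complex line \<open>\<complex> (1, u)\<close>, hence is multiplication by a complex
  number, which must be \<open>\<plusminus>\<i>\<close>. Differentiating \<open>J\<^sup>2 = -1\<close> then shows that every \<open>L(h)\<close> is
  conjugate linear.
\<^item> First order in \<open>a\<close> for the argument \<open>(1, 0)\<close>: \<open>t(L(a v) v) = a T(0, u)\<close> is complex linear in \<open>a\<close>.
\<^item> Second order in \<open>a\<close> for the argument \<open>(0, 1)\<close>: \<open>t(L(a v)(0, a)) = a T'(a)\<close> with \<open>T'\<close> real linear.
  The left-hand side is conjugate linear in the second argument, so a conjugate linear part in
  the first would contribute a multiple of \<open>(cnj a)\<^sup>2\<close>, which is not \<open>a\<close> times a
  real linear map; hence \<open>t(L(a v)(0, 1))\<close> is complex linear in \<open>a\<close> too.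

Consequently \<open>E(h) = L(\<i> h) - \<i> L(h)\<close>, a multiple of the conjugate linear part of \<open>L\<close>, takes at
\<open>h = (1, u)\<close> all its values in the line through \<open>(1, u)\<close>, for every \<open>u\<close>. Being conjugate linear in \<open>h\<close>, it vanishes
(\<open>biconjugate_zero_if_tangential\<close>). So \<open>L\<close> is complex linear in \<open>h\<close>, and the Nijenhuis tensor
\<open>L(J X) Y - L(J Y) X + J L(Y) X - J L(X) Y\<close> cancels (\<open>local_nijenhuis_zero\<close>).

What remains is to connect this computation with manifolds. Brackets are compared between coordinates by
\<open>bracket_of_related_fields\<close>, which rests on the symmetry of second derivatives. The identity for the
lift is established for \<open>a \<noteq> 0\<close>, that is, away from the exceptional divisor
(\<open>pulled_J_lift\<close>), and both sides extend to \<open>a = 0\<close> by continuity. Off the divisor all charts of the blow-up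
factor through the punctured parametrization, and this makes them compatible with each other
(\<open>blowup_atlas_compatible_off_divisor\<close>).\<close>

section \<open>Second derivatives and brackets in vector spaces\<close>

lemma Ck_on_differentiable: "Ck_on (Suc n) f S \<Longrightarrow> z \<in> S \<Longrightarrow> f differentiable (at z)"
  by simp

lemma smooth_on_differentiable: "smooth_on f S \<Longrightarrow> z \<in> S \<Longrightarrow> f differentiable (at z)"
  unfolding smooth_on_def by (rule Ck_on_differentiable[of 0]) auto

lemma smooth_on_directional_derivative:
  assumes "smooth_on f S"
  shows "smooth_on (\<lambda>z. frechet_derivative f (at z) v) S"
  unfolding smooth_on_def
proof
  fix n
  have "Ck_on (Suc n) f S" using assms by (simp add: smooth_on_def)
  then show "Ck_on n (\<lambda>z. frechet_derivative f (at z) v) S" by simp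
qed

lemma Ck_on_cong_open:
  assumes "Ck_on n f S" "open S" "\<And>z. z \<in> S \<Longrightarrow> f z = g z"
  shows "Ck_on n g S"
  using assms
proof (induction n arbitrary: f g)
  case 0
  then show ?case using continuous_on_cong[of S S f g] by simp
next
  case (Suc n)
  have d: "f differentiable (at z)" if "z \<in> S" for z using Suc.prems(1) that by simp
  have e: "frechet_derivative f (at z) = frechet_derivative g (at z)" if "z \<in> S" for z
    by (rule frechet_derivative_transform_within_open[OF d[OF that] Suc.prems(2) that Suc.prems(3)])
  have "g differentiable (at z)" if "z \<in> S" for z
    using d[OF that] Suc.prems(2,3) that
    unfolding differentiable_def by (meson has_derivative_transform_within_open)
  moreover have "Ck_on n (\<lambda>z. frechet_derivative g (at z) v) S" for v
  proof (rule Suc.IH[OF _ Suc.prems(2)])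
    show "Ck_on n (\<lambda>z. frechet_derivative f (at z) v) S" using Suc.prems(1) by simp
  qed (simp only: e)
  ultimately show ?case by simp
qed

text \<open>Identities coming from the blow-up hold only off the exceptional divisor; this lemma and the next one
carry them over to the divisor, first for values and then for derivatives.\<close>

lemma continuous_eq_at_point_if_eq_off_point:
  fixes f g :: "'a::{perfect_space,t2_space} \<Rightarrow> 'b::t2_space"
  assumes "isCont f a" "isCont g a" "\<forall>\<^sub>F x in at a. f x = g x"
  shows "f a = g a"
  using assms tendsto_cong tendsto_unique trivial_limit_at unfolding isCont_def by metis

lemma derivatives_eq_if_eq_off_point:
  fixes f g :: "'a::{real_normed_vector,perfect_space} \<Rightarrow> 'b::real_normed_vector"
  assumes f: "(f has_derivative f') (at a)" and g: "(g has_derivative g') (at a)"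
    and eq: "\<forall>\<^sub>F x in at a. f x = g x"
  shows "f' = g'"
proof -
  have "f a = g a"
    using continuous_eq_at_point_if_eq_off_point[OF _ _ eq] f g has_derivative_continuous by blast
  then have "(g has_derivative f') (at a)"
    using has_derivative_transform_eventually[OF f eq] by simp
  then show ?thesis using g by (rule has_derivative_unique)
qed

lemma derivative_linear_in_parameter:
  fixes A :: "'e::real_normed_vector \<Rightarrow> 'f::real_normed_vector \<Rightarrow> 'g::real_normed_vector"
  assumes lin: "\<forall>\<^sub>F z in nhds z0. linear (A z)"
    and A': "\<And>e. ((\<lambda>z. A z e) has_derivative (\<lambda>h. A' h e)) (at z0)"
  shows "linear (A' h)"
proof (rule linearI)
  have lin0: "linear (A z0)" using lin eventually_nhds_x_imp_x by blast
  have ev: "\<forall>\<^sub>F z in at z0. linear (A z)" using lin by (simp add: eventually_nhds_conv_at)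
  show "A' h (e + e') = A' h e + A' h e'" for e e'
  proof -
    have "((\<lambda>z. A z e + A z e') has_derivative (\<lambda>h. A' h e + A' h e')) (at z0)"
      by (intro has_derivative_add A')
    then have "((\<lambda>z. A z (e + e')) has_derivative (\<lambda>h. A' h e + A' h e')) (at z0)"
      by (rule has_derivative_transform_eventually)
        (use ev lin0 in \<open>auto simp: linear_add elim!: eventually_mono\<close>)
    from has_derivative_unique[OF A' this] show ?thesis by metis
  qed
  show "A' h (c *\<^sub>R e) = c *\<^sub>R A' h e" for c e
  proof -
    have "((\<lambda>z. c *\<^sub>R A z e) has_derivative (\<lambda>h. c *\<^sub>R A' h e)) (at z0)"
      by (intro has_derivative_scaleR_right A')
    then have "((\<lambda>z. A z (c *\<^sub>R e)) has_derivative (\<lambda>h. c *\<^sub>R A' h e)) (at z0)"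
      by (rule has_derivative_transform_eventually)
        (use ev lin0 in \<open>auto simp: linear_scale elim!: eventually_mono\<close>)
    from has_derivative_unique[OF A' this] show ?thesis by metis
  qed
qed

text \<open>The product rule for evaluating a family of linear maps at a moving vector. Only the
derivatives of \<open>A z e\<close> for fixed \<open>e\<close> enter, since an expansion in a basis reduces the general case to them; this is
how smoothness of endomorphisms is formulated.\<close>

lemma has_derivative_linear_family_apply:
  fixes A :: "'e::real_normed_vector \<Rightarrow> 'f::euclidean_space \<Rightarrow> 'g::real_normed_vector"
  assumes lin: "\<forall>\<^sub>F z in nhds z0. linear (A z)"
    and A': "\<And>e. ((\<lambda>z. A z e) has_derivative (\<lambda>h. A' h e)) (at z0)"
    and b: "(b has_derivative b') (at z0)"
  shows "((\<lambda>z. A z (b z)) has_derivative (\<lambda>h. A' h (b z0) + A z0 (b' h))) (at z0)"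
proof -
  have expand: "l e = (\<Sum>i\<in>Basis. (e \<bullet> i) *\<^sub>R l i)" if "linear l" for l :: "'f \<Rightarrow> 'g" and e
  proof -
    have "l e = l (\<Sum>i\<in>Basis. (e \<bullet> i) *\<^sub>R i)" by (simp add: euclidean_representation)
    also have "\<dots> = (\<Sum>i\<in>Basis. (e \<bullet> i) *\<^sub>R l i)"
      using that by (simp add: linear_sum linear_scale)
    finally show ?thesis .
  qed
  have lin0: "linear (A z0)" using lin eventually_nhds_x_imp_x by blast
  have ev: "\<forall>\<^sub>F z in at z0. linear (A z)" using lin by (simp add: eventually_nhds_conv_at)
  have eq: "(\<lambda>h. \<Sum>i\<in>Basis. (b z0 \<bullet> i) *\<^sub>R A' h i + (b' h \<bullet> i) *\<^sub>R A z0 i)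
      = (\<lambda>h. A' h (b z0) + A z0 (b' h))"
    by (simp add: fun_eq_iff sum.distrib
        expand[OF derivative_linear_in_parameter[OF lin A'], symmetric]
        expand[OF lin0, symmetric])
  have "((\<lambda>z. \<Sum>i\<in>Basis. (b z \<bullet> i) *\<^sub>R A z i) has_derivative
      (\<lambda>h. \<Sum>i\<in>Basis. (b z0 \<bullet> i) *\<^sub>R A' h i + (b' h \<bullet> i) *\<^sub>R A z0 i)) (at z0)"
    by (intro has_derivative_sum has_derivative_scaleR has_derivative_inner_left b A')
  then show ?thesis unfolding eq
    by (rule has_derivative_transform_eventually)
      (use ev lin0 in \<open>auto simp: expand[symmetric] elim!: eventually_mono\<close>)
qed

text \<open>Applying the mean value theorem first in direction \<open>v\<close> and then in direction \<open>w\<close> turns the second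
difference over a small parallelogram into a mixed derivative at an intermediate point. The second
difference itself is symmetric in \<open>v\<close> and \<open>w\<close>.\<close>

lemma second_difference_mean_value:
  fixes f :: "'e::real_normed_vector \<Rightarrow> 'f::real_inner"
  assumes C2: "Ck_on (Suc (Suc 0)) f (ball z0 r)"
    and d: "0 < d" "d * (norm v + norm w) < r"
  shows "\<exists>z. dist z z0 \<le> d * (norm v + norm w) \<and>
    c \<bullet> (f (z0 + d *\<^sub>R v + d *\<^sub>R w) - f (z0 + d *\<^sub>R v) - f (z0 + d *\<^sub>R w) + f z0) =
    d * (d * (c \<bullet> frechet_derivative (\<lambda>z. frechet_derivative f (at z) v) (at z) w))"
proof -
  define D where "D z = frechet_derivative f (at z)" for z
  have inball: "norm (s *\<^sub>R v + t *\<^sub>R w) \<le> d * (norm v + norm w)"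
    if "0 \<le> s" "s \<le> d" "0 \<le> t" "t \<le> d" for s t
  proof -
    have "norm (s *\<^sub>R v + t *\<^sub>R w) \<le> s * norm v + t * norm w"
      using that norm_triangle_ineq[of "s *\<^sub>R v" "t *\<^sub>R w"] by simp
    also have "\<dots> \<le> d * norm v + d * norm w"
      using that by (intro add_mono mult_right_mono) auto
    finally show ?thesis by (simp add: algebra_simps)
  qed
  have mem: "z0 + s *\<^sub>R v + t *\<^sub>R w \<in> ball z0 r" if "0 \<le> s" "s \<le> d" "0 \<le> t" "t \<le> d" for s t
  proof -
    have "dist z0 (z0 + s *\<^sub>R v + t *\<^sub>R w) = norm (s *\<^sub>R v + t *\<^sub>R w)"
      by (subst dist_commute) (simp add: dist_norm add.assoc)
    then show ?thesis using inball[OF that] d by simp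
  qed
  have f': "(f has_derivative D z) (at z)" if "z \<in> ball z0 r" for z
    using C2 that by (auto simp: D_def simp flip: frechet_derivative_works)
  have D': "((\<lambda>z. D z v) has_derivative frechet_derivative (\<lambda>z. D z v) (at z)) (at z)"
    if "z \<in> ball z0 r" for z
    using C2 that by (auto simp: D_def simp flip: frechet_derivative_works)
  define g where "g s = c \<bullet> f (z0 + s *\<^sub>R v + d *\<^sub>R w) - c \<bullet> f (z0 + s *\<^sub>R v + 0 *\<^sub>R w)" for s
  have f1: "((\<lambda>s. f (z0 + s *\<^sub>R v + t *\<^sub>R w)) has_derivative
        (\<lambda>h. D (z0 + s *\<^sub>R v + t *\<^sub>R w) (h *\<^sub>R v))) (at s)" if "0 \<le> s" "s \<le> d" "0 \<le> t" "t \<le> d" for s t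
    by (rule has_derivative_compose[where f = "\<lambda>s. z0 + s *\<^sub>R v + t *\<^sub>R w", OF _ f'[OF mem[OF that]]])
      (auto intro!: derivative_eq_intros)
  have lin: "linear (D z)" if "z \<in> ball z0 r" for z
    by (rule has_derivative_linear[OF f'[OF that]])
  have g': "(g has_real_derivative
      c \<bullet> D (z0 + s *\<^sub>R v + d *\<^sub>R w) v - c \<bullet> D (z0 + s *\<^sub>R v + 0 *\<^sub>R w) v) (at s)"
    if "0 \<le> s" "s \<le> d" for s
  proof -
    have lins: "linear (D (z0 + s *\<^sub>R v + d *\<^sub>R w))" "linear (D (z0 + s *\<^sub>R v + 0 *\<^sub>R w))"
      using that d(1) lin[OF mem[of s d]] lin[OF mem[of s 0]] by auto
    show ?thesis unfolding g_def has_field_derivative_def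
      by (rule has_derivative_eq_rhs[OF has_derivative_diff[OF has_derivative_inner_right[OF f1]
            has_derivative_inner_right[OF f1]]])
        (use that d(1) in \<open>simp_all add: fun_eq_iff linear_scale[OF lins(1)]
            linear_scale[OF lins(2), simplified] left_diff_distrib right_diff_distrib mult.commute\<close>)
  qed
  obtain s where s: "0 < s" "s < d" and gs: "g d - g 0 = (d - 0) *
      (c \<bullet> D (z0 + s *\<^sub>R v + d *\<^sub>R w) v - c \<bullet> D (z0 + s *\<^sub>R v + 0 *\<^sub>R w) v)"
    using MVT2[OF d(1) g'] by blast
  define h where "h t = c \<bullet> D (z0 + s *\<^sub>R v + t *\<^sub>R w) v" for t
  define DD where "DD t = frechet_derivative (\<lambda>z. D z v) (at (z0 + s *\<^sub>R v + t *\<^sub>R w))" for t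
  have h': "(h has_real_derivative c \<bullet> DD t w) (at t)"
    if "0 \<le> t" "t \<le> d" for t
  proof -
    have mem': "z0 + s *\<^sub>R v + t *\<^sub>R w \<in> ball z0 r" using s that mem[of s t] by auto
    have lin2: "linear (DD t)" unfolding DD_def
      by (rule has_derivative_linear[OF D'[OF mem']])
    have "((\<lambda>t. D (z0 + s *\<^sub>R v + t *\<^sub>R w) v) has_derivative (\<lambda>k. DD t (k *\<^sub>R w))) (at t)"
      unfolding DD_def
      by (rule has_derivative_compose[where f = "\<lambda>t. z0 + s *\<^sub>R v + t *\<^sub>R w", OF _ D'[OF mem']])
        (auto intro!: derivative_eq_intros)
    from has_derivative_inner_right[OF this, of c]
    show ?thesis unfolding h_def has_field_derivative_def
      by (rule has_derivative_eq_rhs) (auto simp: linear_scale[OF lin2])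
  qed
  obtain t where t: "0 < t" "t < d" and ht: "h d - h 0 = (d - 0) * (c \<bullet> DD t w)"
    using MVT2[OF d(1) h'] by blast
  have "g d - g 0 = d * (d * (c \<bullet> DD t w))"
    unfolding gs using ht by (simp add: h_def)
  moreover have "g d - g 0 =
      c \<bullet> (f (z0 + d *\<^sub>R v + d *\<^sub>R w) - f (z0 + d *\<^sub>R v) - f (z0 + d *\<^sub>R w) + f z0)"
    by (simp add: g_def inner_diff_right inner_add_right)
  moreover have "dist (z0 + s *\<^sub>R v + t *\<^sub>R w) z0 \<le> d * (norm v + norm w)"
    using inball[of s t] s t by (simp add: dist_norm add.assoc)
  ultimately show ?thesis
    unfolding DD_def D_def by (intro exI[of _ "z0 + s *\<^sub>R v + t *\<^sub>R w"] conjI) simp_all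
qed

lemma second_derivative_symmetric:
  fixes f :: "'e::real_normed_vector \<Rightarrow> 'f::real_inner"
  assumes C2: "Ck_on (Suc (Suc 0)) f S" and S: "open S" "z0 \<in> S"
  shows "frechet_derivative (\<lambda>z. frechet_derivative f (at z) v) (at z0) w =
         frechet_derivative (\<lambda>z. frechet_derivative f (at z) w) (at z0) v"
proof -
  define D2 where "D2 p q z = frechet_derivative (\<lambda>z. frechet_derivative f (at z) p) (at z) q" for p q z
  have cont: "continuous_on S (D2 p q)" for p q using C2 by (simp add: D2_def)
  obtain r where r: "r > 0" "ball z0 r \<subseteq> S" using S openE by blast
  have mono: "Ck_on n g T" if "Ck_on n g S" "T \<subseteq> S" for n and g :: "'e \<Rightarrow> 'f" and T
    using that by (induction n arbitrary: g) (auto intro: continuous_on_subset)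
  have C2': "Ck_on (Suc (Suc 0)) f (ball z0 r)" using mono C2 r by blast
  \<comment> \<open>Both mixed derivatives equal the same difference quotient at points arbitrarily close to \<open>z0\<close>.\<close>
  have eq: "c \<bullet> D2 v w z0 = c \<bullet> D2 w v z0" for c
  proof (rule ccontr)
    assume neq: "c \<bullet> D2 v w z0 \<noteq> c \<bullet> D2 w v z0"
    define e where "e = \<bar>c \<bullet> D2 v w z0 - c \<bullet> D2 w v z0\<bar> / 2"
    have e: "e > 0" using neq by (simp add: e_def)
    have near: "\<exists>r1>0. \<forall>z\<in>S. dist z z0 < r1 \<longrightarrow> dist (c \<bullet> D2 p q z) (c \<bullet> D2 p q z0) < e" for p q
      using continuous_on_inner[OF continuous_on_const cont] S(2) e
      unfolding continuous_on_iff by blast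
    obtain r1 where r1: "r1 > 0"
      "\<And>z. z \<in> S \<Longrightarrow> dist z z0 < r1 \<Longrightarrow> dist (c \<bullet> D2 v w z) (c \<bullet> D2 v w z0) < e"
      using near by blast
    obtain r2 where r2: "r2 > 0"
      "\<And>z. z \<in> S \<Longrightarrow> dist z z0 < r2 \<Longrightarrow> dist (c \<bullet> D2 w v z) (c \<bullet> D2 w v z0) < e"
      using near by blast
    define m where "m = Min {r, r1, r2}"
    have m: "m > 0" "m \<le> r" "m \<le> r1" "m \<le> r2" using r r1 r2 by (auto simp: m_def)
    \<comment> \<open>The summand 1 keeps the quotient meaningful for \<open>v = w = 0\<close>.\<close>
    define d where "d = m / (norm v + norm w + 1)"
    have pos: "norm v + norm w + 1 > 0" by (simp add: add_nonneg_pos)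
    have d: "d > 0" "d * (norm v + norm w) < m"
      using m pos by (auto simp: d_def field_simps)
    have d': "d * (norm w + norm v) < m" using d by (simp add: add.commute)
    let ?\<Delta> = "c \<bullet> (f (z0 + d *\<^sub>R v + d *\<^sub>R w) - f (z0 + d *\<^sub>R v) - f (z0 + d *\<^sub>R w) + f z0)"
    have \<Delta>_sym: "?\<Delta> =
        c \<bullet> (f (z0 + d *\<^sub>R w + d *\<^sub>R v) - f (z0 + d *\<^sub>R w) - f (z0 + d *\<^sub>R v) + f z0)"
      by (simp add: algebra_simps)
    obtain P where P: "dist P z0 < m" "?\<Delta> = d * (d * (c \<bullet> D2 v w P))"
      using second_difference_mean_value[OF C2' d(1) less_le_trans[OF d(2) m(2)], of c]
        order_le_less_trans[OF _ d(2)] unfolding D2_def by blast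
    obtain Q where Q: "dist Q z0 < m" "?\<Delta> = d * (d * (c \<bullet> D2 w v Q))"
      using second_difference_mean_value[OF C2' d(1) less_le_trans[OF d' m(2)], of c]
        order_le_less_trans[OF _ d'] unfolding D2_def \<Delta>_sym by blast
    have "P \<in> S" "Q \<in> S" using P Q m r by (auto simp: dist_commute subset_iff)
    then have "\<bar>c \<bullet> D2 v w P - c \<bullet> D2 v w z0\<bar> < e" "\<bar>c \<bullet> D2 w v Q - c \<bullet> D2 w v z0\<bar> < e"
      using r1 r2 P Q m by (auto simp: dist_real_def)
    moreover have "c \<bullet> D2 v w P = c \<bullet> D2 w v Q" using P Q d by simp
    ultimately show False unfolding e_def by (auto simp: abs_if split: if_splits)
  qed
  have "(D2 v w z0 - D2 w v z0) \<bullet> (D2 v w z0 - D2 w v z0) = 0"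
    using eq[of "D2 v w z0 - D2 w v z0"] by (simp add: inner_simps)
  then show ?thesis by (simp add: D2_def)
qed

definition local_bracket :: "('e::real_normed_vector \<Rightarrow> 'e) \<Rightarrow> ('e \<Rightarrow> 'e) \<Rightarrow> 'e \<Rightarrow> 'e" where
  "local_bracket X Y z = frechet_derivative Y (at z) (X z) - frechet_derivative X (at z) (Y z)"

lemma local_bracket_cong:
  assumes X: "X differentiable (at z)" and Y: "Y differentiable (at z)" and S: "open S" "z \<in> S"
    and eq: "\<And>y. y \<in> S \<Longrightarrow> X y = X' y" "\<And>y. y \<in> S \<Longrightarrow> Y y = Y' y"
  shows "local_bracket X Y z = local_bracket X' Y' z"
  unfolding local_bracket_def
  using frechet_derivative_transform_within_open[OF X S eq(1)]
    frechet_derivative_transform_within_open[OF Y S eq(2)] eq[OF S(2)] by simp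

text \<open>Differentiating \<open>X' (\<theta> z) = D\<theta> z (X z)\<close> produces, besides the expected term, the second derivative of \<open>\<theta>\<close>
applied to the two fields. Its symmetry makes these contributions cancel in the bracket.\<close>

lemma bracket_of_related_fields:
  fixes \<theta> :: "'e::euclidean_space \<Rightarrow> 'f::euclidean_space"
  assumes C2: "Ck_on (Suc (Suc 0)) \<theta> S" and S: "open S" "z0 \<in> S"
    and X: "X differentiable (at z0)" and Y: "Y differentiable (at z0)"
    and X': "X' differentiable (at (\<theta> z0))" and Y': "Y' differentiable (at (\<theta> z0))"
    and relX: "\<forall>\<^sub>F z in nhds z0. X' (\<theta> z) = frechet_derivative \<theta> (at z) (X z)"
    and relY: "\<forall>\<^sub>F z in nhds z0. Y' (\<theta> z) = frechet_derivative \<theta> (at z) (Y z)"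
  shows "local_bracket X' Y' (\<theta> z0) = frechet_derivative \<theta> (at z0) (local_bracket X Y z0)"
proof -
  define D where "D z = frechet_derivative \<theta> (at z)" for z
  define D2 where "D2 h e = frechet_derivative (\<lambda>z. D z e) (at z0) h" for h e
  have \<theta>': "(\<theta> has_derivative D z) (at z)" if "z \<in> S" for z
    using C2 that by (auto simp: D_def simp flip: frechet_derivative_works)
  have D': "((\<lambda>z. D z e) has_derivative (\<lambda>h. D2 h e)) (at z0)" for e
    using C2 S by (auto simp: D_def D2_def simp flip: frechet_derivative_works)
  have linD: "\<forall>\<^sub>F z in nhds z0. linear (D z)"
    by (rule eventually_mono[OF eventually_nhds_in_open[OF S]]) (rule has_derivative_linear[OF \<theta>'])
  have linD0: "linear (D z0)" using linD eventually_nhds_x_imp_x by blast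
  have key: "frechet_derivative Z' (at (\<theta> z0)) (D z0 h) = D2 h (Z z0) + D z0 (frechet_derivative Z (at z0) h)"
    if Z: "Z differentiable (at z0)" and Z': "Z' differentiable (at (\<theta> z0))"
      and rel: "\<forall>\<^sub>F z in nhds z0. Z' (\<theta> z) = D z (Z z)" for Z Z' h
  proof -
    have "((\<lambda>z. D z (Z z)) has_derivative
        (\<lambda>h. D2 h (Z z0) + D z0 (frechet_derivative Z (at z0) h))) (at z0)"
      by (rule has_derivative_linear_family_apply[OF linD D'])
        (rule Z[unfolded frechet_derivative_works])
    moreover have "((\<lambda>z. Z' (\<theta> z)) has_derivative
        (\<lambda>h. frechet_derivative Z' (at (\<theta> z0)) (D z0 h))) (at z0)"
      by (rule has_derivative_compose[OF \<theta>'[OF S(2)]]) (rule Z'[unfolded frechet_derivative_works])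
    moreover have "\<forall>\<^sub>F z in at z0. Z' (\<theta> z) = D z (Z z)"
      using rel by (simp add: eventually_nhds_conv_at)
    ultimately show ?thesis
      by (auto dest: derivatives_eq_if_eq_off_point fun_cong)
  qed
  have X0: "X' (\<theta> z0) = D z0 (X z0)" and Y0: "Y' (\<theta> z0) = D z0 (Y z0)"
    unfolding D_def using relX relY by (auto dest: eventually_nhds_x_imp_x)
  have sym: "D2 (X z0) (Y z0) = D2 (Y z0) (X z0)"
    unfolding D2_def D_def by (rule second_derivative_symmetric[OF C2 S])
  have keyX: "frechet_derivative X' (at (\<theta> z0)) (D z0 h) = D2 h (X z0) + D z0 (frechet_derivative X (at z0) h)" for h
    by (rule key[OF X X']) (use relX in \<open>simp add: D_def\<close>)
  have keyY: "frechet_derivative Y' (at (\<theta> z0)) (D z0 h) = D2 h (Y z0) + D z0 (frechet_derivative Y (at z0) h)" for h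
    by (rule key[OF Y Y']) (use relY in \<open>simp add: D_def\<close>)
  show ?thesis
    unfolding local_bracket_def X0 Y0 keyX keyY D_def[symmetric] linear_diff[OF linD0] sym by simp
qed

section \<open>Linear algebra over the complex numbers\<close>

definition cscale :: "complex \<Rightarrow> C2 \<Rightarrow> C2" where
  "cscale c e = (c * fst e, c * snd e)"

lemma cscale_simps [simp]:
  "cscale c (p, q) = (c * p, c * q)"
  "fst (cscale c e) = c * fst e" "snd (cscale c e) = c * snd e"
  "cscale c (cscale d e) = cscale (c * d) e"
  by (simp_all add: cscale_def)

lemma cscale_diff: "cscale c (e - e') = cscale c e - cscale c e'"
  and cscale_minus: "cscale c (- e) = - cscale c e"
  and cscale_minus_left: "cscale (- c) e = - cscale c e"
  and cscale_one: "cscale 1 e = e"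
  by (simp_all add: cscale_def prod_eq_iff algebra_simps)

lemma cscale_real_imaginary: "cscale c e = Re c *\<^sub>R e + Im c *\<^sub>R cscale \<i> e"
  by (simp add: cscale_def prod_eq_iff complex_eq_iff)

definition conjugate_linear :: "(C2 \<Rightarrow> C2) \<Rightarrow> bool" where
  "conjugate_linear f \<longleftrightarrow> linear f \<and> (\<forall>e. f (cscale \<i> e) = - cscale \<i> (f e))"

lemma conjugate_linear_cscale:
  assumes "conjugate_linear f"
  shows "f (cscale c e) = cscale (cnj c) (f e)"
proof -
  have f: "linear f" using assms by (simp add: conjugate_linear_def)
  have fi: "f (cscale \<i> e) = - cscale \<i> (f e)"
    using assms unfolding conjugate_linear_def by blast
  have "f (cscale c e) = Re c *\<^sub>R f e + Im c *\<^sub>R f (cscale \<i> e)"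
    by (subst cscale_real_imaginary) (simp only: linear_add[OF f] linear_scale[OF f])
  also have "\<dots> = cscale (cnj c) (f e)"
    using fi by (subst cscale_real_imaginary[of "cnj c"]) simp
  finally show ?thesis .
qed

text \<open>Comparing the lines \<open>u = 0, 1, -1\<close> shows that \<open>F\<close> acts by one and the same map on both coordinates; the
other lines force this map to commute with multiplication by \<open>u\<close>.\<close>

lemma complex_scalar_if_preserves_lines:
  fixes F :: "C2 \<Rightarrow> C2"
  assumes F: "linear F" and lines: "\<And>u \<alpha>. \<exists>s. F (\<alpha>, u * \<alpha>) = (s, u * s)"
  shows "\<exists>c. \<forall>e. F e = cscale c e"
proof -
  define A C D where "A \<alpha> = fst (F (\<alpha>, 0))" and "C \<beta> = fst (F (0, \<beta>))" and "D \<beta> = snd (F (0, \<beta>))" for \<alpha> \<beta>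
  have F1: "F (\<alpha>, 0) = (A \<alpha>, 0)" for \<alpha>
    using lines[of \<alpha> 0] by (auto simp: A_def)
  have F2: "F (0, \<beta>) = (C \<beta>, D \<beta>)" for \<beta> by (simp add: C_def D_def)
  have F12: "F (\<alpha>, \<beta>) = (A \<alpha> + C \<beta>, D \<beta>)" for \<alpha> \<beta>
    using linear_add[OF F, of "(\<alpha>, 0)" "(0, \<beta>)"] by (simp add: F1 F2)
  have D: "D (u * \<alpha>) = u * (A \<alpha> + C (u * \<alpha>))" for u \<alpha>
    using lines[of \<alpha> u] by (auto simp: F12)
  have neg: "C (- \<beta>) = - C \<beta>" "D (- \<beta>) = - D \<beta>" for \<beta>
    using linear_neg[OF F, of "(0, \<beta>)"] by (simp_all add: F2)
  have C0: "C \<alpha> = 0" for \<alpha>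
    using D[of 1 \<alpha>] D[of "-1" \<alpha>] by (simp add: neg)
  have DA: "D \<alpha> = A \<alpha>" for \<alpha> using D[of 1 \<alpha>] by (simp add: C0)
  have A: "A u = u * A 1" for u using D[of u 1] by (simp add: C0 DA)
  have "F e = cscale (A 1) e" for e
    using F12[of "fst e" "snd e"] A[of "fst e"] A[of "snd e"]
    by (simp add: C0 DA prod_eq_iff mult.commute)
  then show ?thesis by blast
qed

text \<open>A linear coordinate whose kernel is the complex line through \<open>(1, u)\<close>.\<close>
definition transversal :: "complex \<Rightarrow> C2 \<Rightarrow> complex" where
  "transversal u e = snd e - u * fst e"

lemma transversal_linear: "bounded_linear (transversal u)"
  unfolding transversal_def
  by (intro bounded_linear_sub bounded_linear_snd bounded_linear_compose[OF bounded_linear_mult_right] bounded_linear_fst)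

lemma transversal_simps:
  "transversal u (e + e') = transversal u e + transversal u e'"
  "transversal u (e - e') = transversal u e - transversal u e'"
  "transversal u (- e) = - transversal u e"
  "transversal u (r *\<^sub>R e) = r *\<^sub>R transversal u e"
  "transversal u (cscale c e) = c * transversal u e"
  by (simp_all add: transversal_def algebra_simps)

text \<open>Because \<open>(1, u)\<close> and \<open>(0, 1)\<close> span \<open>\<complex>\<^sup>2\<close>, the hypotheses say that \<open>E (1, u)\<close> has all its values in
the line through \<open>(1, u)\<close>. With \<open>E (1, 0) e = (p1, q1)\<close> and \<open>E (0, 1) e = (p2, q2)\<close> this is the identity
\<open>q1 + cnj u * q2 - u * p1 - u * cnj u * p2 = 0\<close> for all \<open>u\<close>, and the four functions \<open>1\<close>, \<open>u\<close>, \<open>cnj u\<close>, \<open>u * cnj u\<close> are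
linearly independent.\<close>

lemma biconjugate_zero_if_tangential:
  assumes E1: "\<And>e. conjugate_linear (\<lambda>h. E h e)" and E2: "\<And>h. conjugate_linear (E h)"
    and t1: "\<And>u. transversal u (E (1, u) (1, u)) = 0"
    and t2: "\<And>u. transversal u (E (1, u) (0, 1)) = 0"
  shows "E h e = 0"
proof -
  have tang: "transversal u (E (1, u) e) = 0" for u e
  proof -
    have "e = cscale (fst e) (1, u) + cscale (snd e - u * fst e) (0, 1)"
      by (simp add: prod_eq_iff)
    then have "E (1, u) e = cscale (cnj (fst e)) (E (1, u) (1, u)) +
        cscale (cnj (snd e - u * fst e)) (E (1, u) (0, 1))"
      using E2[of "(1, u)"] conjugate_linear_cscale[OF E2] linear_add
      unfolding conjugate_linear_def by metis
    then show ?thesis by (simp add: transversal_simps t1 t2)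
  qed
  have exp: "E h e = cscale (cnj (fst h)) (E (1, 0) e) + cscale (cnj (snd h)) (E (0, 1) e)" for h
  proof -
    have "h = cscale (fst h) (1, 0) + cscale (snd h) (0, 1)" by (simp add: prod_eq_iff)
    then show ?thesis
      using E1[of e] conjugate_linear_cscale[OF E1] linear_add
      unfolding conjugate_linear_def by metis
  qed
  obtain p1 q1 p2 q2 where pq: "E (1, 0) e = (p1, q1)" "E (0, 1) e = (p2, q2)" by fastforce
  have eq: "q1 + cnj u * q2 - u * (p1 + cnj u * p2) = 0" for u
    using tang[of u e] exp[of "(1, u)"] by (simp add: pq transversal_def)
  have q1: "q1 = 0" using eq[of 0] by simp
  have 1: "q2 - p1 - p2 = 0" using eq[of 1] by (simp add: q1)
  have 2: "- q2 + p1 - p2 = 0" using eq[of "-1"] by (simp add: q1 algebra_simps)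
  have p2: "p2 = 0" using 1 2 by (simp add: complex_eq_iff)
  have "- (\<i> * q2) - \<i> * p1 = 0" using eq[of \<i>] by (simp add: q1 p2)
  then have "q2 = 0" "p1 = 0" using 1 p2 by (simp_all add: complex_eq_iff)
  then show ?thesis using exp[of h] by (simp add: pq q1 p2 zero_prod_def)
qed

text \<open>The differential at \<open>(a, u)\<close> of the blow-down \<open>(a, u) \<mapsto> (a, a u)\<close>.\<close>
definition blowdown_diff :: "complex \<Rightarrow> complex \<Rightarrow> C2 \<Rightarrow> C2" where
  "blowdown_diff a u e = (fst e, a * snd e + u * fst e)"

text \<open>An almost complex structure \<open>J\<close> near the origin of \<open>\<complex>\<^sup>2\<close>, differentiable there with derivative \<open>L\<close>, whose lift \<open>K\<close> to
the chart \<open>(a, u)\<close> of the blow-up extends differentiably across \<open>a = 0\<close> along each curve of constant \<open>u\<close>.\<close>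

locale liftable_structure =
  fixes J L :: "C2 \<Rightarrow> C2 \<Rightarrow> C2"
  assumes lin: "\<forall>\<^sub>F z in nhds 0. linear (J z)"
    and sq: "\<forall>\<^sub>F z in nhds 0. \<forall>e. J z (J z e) = - e"
    and L: "\<And>e. ((\<lambda>z. J z e) has_derivative (\<lambda>h. L h e)) (at 0)"
    and lift: "\<And>u e. \<exists>K. K differentiable (at 0) \<and>
      (\<forall>\<^sub>F a in at 0. J (a, a * u) (blowdown_diff a u e) = blowdown_diff a u (K a))"
begin

lemma linear_J0: "linear (J 0)"
  using lin eventually_nhds_x_imp_x by blast

lemma J0_J0: "J 0 (J 0 e) = - e"
  using sq eventually_nhds_x_imp_x by blast

lemma linear_L: "linear (L h)"
  using derivative_linear_in_parameter[OF lin L] .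

lemma linear_L_left: "linear (\<lambda>h. L h e)"
  using has_derivative_linear[OF L] .

lemma derivative_along_line:
  "((\<lambda>a. J (a, a * u) e) has_derivative (\<lambda>h. L (h, h * u) e)) (at 0)"
proof -
  have "((\<lambda>a. (a, a * u)) has_derivative (\<lambda>h. (h, h * u))) (at 0)"
    by (auto intro!: derivative_eq_intros)
  then show ?thesis
    by (rule has_derivative_compose) (simp add: L flip: zero_prod_def)
qed

lemma J0_complex_scalar: "\<exists>c. \<forall>e. J 0 e = cscale c e"
proof (rule complex_scalar_if_preserves_lines[OF linear_J0])
  fix u \<alpha>
  obtain K where K: "K differentiable (at 0)"
    and ev: "\<forall>\<^sub>F a in at 0. J (a, a * u) (blowdown_diff a u (\<alpha>, 0)) = blowdown_diff a u (K a)"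
    using lift by blast
  have contK: "isCont K 0" using K differentiable_imp_continuous_within by blast
  have "isCont (\<lambda>a. J (a, a * u) (\<alpha>, u * \<alpha>)) 0"
    using has_derivative_continuous[OF derivative_along_line] .
  moreover have "isCont (\<lambda>a. blowdown_diff a u (K a)) 0"
    unfolding blowdown_diff_def by (intro continuous_intros contK)
  ultimately have "J (0, 0 * u) (\<alpha>, u * \<alpha>) = blowdown_diff 0 u (K 0)"
    by (rule continuous_eq_at_point_if_eq_off_point) (use ev in \<open>simp add: blowdown_diff_def\<close>)
  then show "\<exists>s. J 0 (\<alpha>, u * \<alpha>) = (s, u * s)"
    by (auto simp: blowdown_diff_def zero_prod_def)
qed

text \<open>The transversal component of \<open>J (a, a * u) (1, u)\<close> is \<open>a\<close> times a function continuous at \<open>a = 0\<close>, so its derivative there is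
multiplication by the value of that function.\<close>

lemma tangential_part_complex_linear:
  "transversal u (L (h, h * u) (1, u)) = h * transversal u (L (1, u) (1, u))"
proof -
  obtain K where K: "K differentiable (at 0)"
    and ev: "\<forall>\<^sub>F a in at 0. J (a, a * u) (blowdown_diff a u (1, 0)) = blowdown_diff a u (K a)"
    using lift by blast
  obtain K' where K': "(K has_derivative K') (at 0)" using K by (auto simp: differentiable_def)
  have "((\<lambda>a. transversal u (J (a, a * u) (1, u))) has_derivative
      (\<lambda>h. transversal u (L (h, h * u) (1, u)))) (at 0)"
    by (rule bounded_linear.has_derivative[OF transversal_linear derivative_along_line])
  moreover have "((\<lambda>a. a * snd (K a)) has_derivative (\<lambda>h. h * snd (K 0))) (at 0)"
    by (rule has_derivative_eq_rhs[OF has_derivative_mult[OF has_derivative_ident has_derivative_snd[OF K']]]) simp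
  moreover have "\<forall>\<^sub>F a in at 0. transversal u (J (a, a * u) (1, u)) = a * snd (K a)"
    using ev by eventually_elim (simp add: blowdown_diff_def transversal_def)
  ultimately have "(\<lambda>h. transversal u (L (h, h * u) (1, u))) = (\<lambda>h. h * snd (K 0))"
    by (rule derivatives_eq_if_eq_off_point)
  from fun_cong[OF this, of h] fun_cong[OF this, of 1] show ?thesis by simp
qed

text \<open>The lift of \<open>(0, 1)\<close> involves \<open>J (a, a * u) (0, a)\<close>, which vanishes to first order at \<open>a = 0\<close>. Along a real ray
\<open>a = t h\<close> the factor \<open>t\<close> can be divided out by real linearity, and the derivative of what is left
brings in the derivative \<open>T\<close> of the second component of the lift.\<close>

lemma transversal_part_divisible:
  "\<exists>T. linear T \<and> (\<forall>h. transversal u (L (h, h * u) (0, h)) = h * T h)"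
proof -
  obtain K where K: "K differentiable (at 0)"
    and ev: "\<forall>\<^sub>F a in at 0. J (a, a * u) (blowdown_diff a u (0, 1)) = blowdown_diff a u (K a)"
    using lift by blast
  obtain K' where K': "(K has_derivative K') (at 0)" using K by (auto simp: differentiable_def)
  have K2: "((\<lambda>a. snd (K a)) has_derivative (\<lambda>h. snd (K' h))) (at 0)"
    by (rule has_derivative_snd[OF K'])
  have lin2: "\<forall>\<^sub>F a in at 0. linear (J (a, a * u))"
  proof -
    have "((\<lambda>a. (a, a * u)) \<longlongrightarrow> 0) (at 0)"
      by (auto intro!: tendsto_eq_intros simp: zero_prod_def)
    from filterlim_iff[THEN iffD1, OF this] lin show ?thesis by blast
  qed
  have "transversal u (L (h, h * u) (0, h)) = h * snd (K' h)" for h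
  proof (cases "h = 0")
    case True
    then show ?thesis using linear_0[OF linear_L] by (simp add: transversal_def flip: zero_prod_def)
  next
    case False
    have lim: "filterlim (\<lambda>t. t *\<^sub>R h) (at 0) (at (0::real))"
    proof (rule filterlim_atI)
      show "((\<lambda>t. t *\<^sub>R h) \<longlongrightarrow> 0) (at (0::real))" by (auto intro!: tendsto_eq_intros)
      show "\<forall>\<^sub>F t in at (0::real). t *\<^sub>R h \<noteq> 0"
        using False by (auto simp: eventually_at intro: exI[of _ 1])
    qed
    have sc: "((\<lambda>t. t *\<^sub>R h) has_derivative (\<lambda>t. t *\<^sub>R h)) (at (0::real))"
      by (auto intro!: derivative_eq_intros)
    have "((\<lambda>t. transversal u (J (t *\<^sub>R h, t *\<^sub>R h * u) (0, h))) has_derivative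
        (\<lambda>t. transversal u (L (t *\<^sub>R h, t *\<^sub>R h * u) (0, h)))) (at (0::real))"
      by (rule bounded_linear.has_derivative[OF transversal_linear])
        (rule has_derivative_compose[OF sc], simp add: derivative_along_line)
    moreover have "((\<lambda>t. h * snd (K (t *\<^sub>R h))) has_derivative (\<lambda>t. h * snd (K' (t *\<^sub>R h)))) (at (0::real))"
      by (rule has_derivative_mult_right, rule has_derivative_compose[OF sc]) (simp add: K2)
    moreover have "\<forall>\<^sub>F t in at (0::real).
        transversal u (J (t *\<^sub>R h, t *\<^sub>R h * u) (0, h)) = h * snd (K (t *\<^sub>R h))"
    proof -
      have "\<forall>\<^sub>F a in at 0. a \<noteq> (0::complex)" by (simp add: eventually_at_filter)
      with ev lin2 have "\<forall>\<^sub>F a in at 0. transversal u (J (a, a * u) (0, a)) = a * snd (K a) \<and>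
          linear (J (a, a * u)) \<and> a \<noteq> 0"
        by eventually_elim (simp add: blowdown_diff_def transversal_def)
      from filterlim_iff[THEN iffD1, OF lim, rule_format, OF this] show ?thesis
      proof eventually_elim
        case (elim t)
        then have l: "linear (J (t *\<^sub>R h, t *\<^sub>R h * u))" and t: "t \<noteq> 0" by auto
        have "(0::complex, t *\<^sub>R h) = t *\<^sub>R (0, h)" by simp
        then have "J (t *\<^sub>R h, t *\<^sub>R h * u) (0, t *\<^sub>R h) = t *\<^sub>R J (t *\<^sub>R h, t *\<^sub>R h * u) (0, h)"
          using linear_scale[OF l] by metis
        then have "t *\<^sub>R transversal u (J (t *\<^sub>R h, t *\<^sub>R h * u) (0, h)) = t *\<^sub>R (h * snd (K (t *\<^sub>R h)))"
          using elim by (metis transversal_simps(4) mult_scaleR_left)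
        then show ?case using t by (simp del: scaleR_conv_of_real)
      qed
    qed
    ultimately have "(\<lambda>t. transversal u (L (t *\<^sub>R h, t *\<^sub>R h * u) (0, h))) = (\<lambda>t. h * snd (K' (t *\<^sub>R h)))"
      by (rule derivatives_eq_if_eq_off_point)
    from fun_cong[OF this, of 1] show ?thesis by simp
  qed
  moreover have "linear (\<lambda>h. snd (K' h))" using has_derivative_linear[OF K2] .
  ultimately show ?thesis by blast
qed

text \<open>Differentiate \<open>J z (J z e) = - e\<close> at the origin.\<close>

lemma L_J0: "L h (J 0 e) = - J 0 (L h e)"
proof -
  have "((\<lambda>z. J z (J z e)) has_derivative (\<lambda>h. L h (J 0 e) + J 0 (L h e))) (at 0)"
    by (rule has_derivative_linear_family_apply[OF lin L L])
  moreover have "((\<lambda>z. - e) has_derivative (\<lambda>h. 0)) (at 0)" by simp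
  moreover have "\<forall>\<^sub>F z in at 0. J z (J z e) = - e"
    using sq unfolding eventually_nhds_conv_at by (auto elim!: eventually_mono simp del: split_paired_All)
  ultimately have "(\<lambda>h. L h (J 0 e) + J 0 (L h e)) = (\<lambda>h. 0)"
    by (rule derivatives_eq_if_eq_off_point)
  from fun_cong[OF this, of h] show ?thesis by (simp add: eq_neg_iff_add_eq_0)
qed

lemma J0_cases:
  obtains "\<And>e. J 0 e = cscale \<i> e" | "\<And>e. J 0 e = cscale (-\<i>) e"
proof -
  obtain c where c: "\<And>e. J 0 e = cscale c e" using J0_complex_scalar by blast
  have "c * c = \<i> * \<i>" using J0_J0[of "(1, 1)"] by (simp add: c)
  then have "c = \<i> \<or> c = - \<i>" using square_eq_iff by blast
  then show ?thesis using c that by blast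
qed

lemma conjugate_linear_L: "conjugate_linear (L h)"
  unfolding conjugate_linear_def
proof (intro conjI allI linear_L)
  fix e
  show "L h (cscale \<i> e) = - cscale \<i> (L h e)"
  proof (rule J0_cases)
    assume "\<And>e. J 0 e = cscale \<i> e"
    then show ?thesis using L_J0[of h e] by simp
  next
    assume "\<And>e. J 0 e = cscale (-\<i>) e"
    then have "L h (- cscale \<i> e) = cscale \<i> (L h e)"
      using L_J0[of h e] by (simp add: cscale_minus_left)
    then show ?thesis using linear_neg[OF linear_L] by (metis minus_minus)
  qed
qed

text \<open>This is where the lift enters: the failure \<open>E\<close> of complex linearity in \<open>h\<close> is conjugate linear in both
arguments, and the two expansions in \<open>a\<close> show that it is tangential on \<open>(1, u)\<close> and on \<open>(0, 1)\<close>.\<close>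

lemma L_cscale_left: "L (cscale \<i> h) e = cscale \<i> (L h e)"
proof -
  define E where "E h e = L (cscale \<i> h) e - cscale \<i> (L h e)" for h e
  have cadd: "linear (cscale c)" for c
    by (rule linearI) (simp_all add: cscale_def algebra_simps)
  have E1: "conjugate_linear (\<lambda>h. E h e)" for e
    unfolding conjugate_linear_def
  proof (intro conjI allI)
    show "linear (\<lambda>h. E h e)"
      unfolding E_def
      by (intro linear_compose_sub linear_compose[OF cadd linear_L_left, unfolded o_def]
          linear_compose[OF linear_L_left cadd, unfolded o_def])
    show "E (cscale \<i> h) e = - cscale \<i> (E h e)" for h
      by (simp add: E_def cscale_minus cscale_minus_left cscale_one cscale_diff linear_neg[OF linear_L_left])
  qed
  have E2: "conjugate_linear (E h)" for h
    unfolding conjugate_linear_def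
  proof (intro conjI allI)
    show "linear (E h)"
      unfolding E_def
      by (intro linear_compose_sub linear_L linear_compose[OF linear_L cadd, unfolded o_def])
    show "E h (cscale \<i> e) = - cscale \<i> (E h e)" for e
      by (simp add: E_def conjugate_linear_cscale[OF conjugate_linear_L] cscale_minus cscale_minus_left
          cscale_one cscale_diff)
  qed
  have "E h e = 0"
  proof (rule biconjugate_zero_if_tangential[OF E1 E2])
    fix u
    show "transversal u (E (1, u) (1, u)) = 0"
      using tangential_part_complex_linear[of u \<i>] by (simp add: E_def transversal_simps)
    obtain T where T: "linear T" and eq: "\<And>h. transversal u (L (h, h * u) (0, h)) = h * T h"
      using transversal_part_divisible by blast
    \<comment> \<open>With \<open>B h \<i> = - \<i> * B h 1\<close>, the values of \<open>B h h = h * T h\<close> at \<open>1\<close>, \<open>\<i>\<close> and \<open>1 + \<i>\<close> determine \<open>B \<i> 1\<close>.\<close>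
    define B where "B h w = transversal u (L (h, h * u) (0, w))" for h w
    have B1: "B (h + h') w = B h w + B h' w" for h h' w
      using linear_add[OF linear_L_left, of "(h, h * u)" "(h', h' * u)" "(0, w)"]
      by (simp add: B_def transversal_simps algebra_simps)
    have B2: "B h (w + w') = B h w + B h w'" for h w w'
      using linear_add[OF linear_L, of "(h, h * u)" "(0, w)" "(0, w')"]
      by (simp add: B_def transversal_simps)
    have Bi: "B h \<i> = - \<i> * B h 1" for h
      using conjugate_linear_cscale[OF conjugate_linear_L, of "(h, h * u)" \<i> "(0, 1)"]
      by (simp add: B_def transversal_simps)
    have eqB: "B h h = h * T h" for h using eq by (simp add: B_def)
    have "B 1 1 = T 1" using eqB[of 1] by simp
    moreover have "B \<i> 1 = - T \<i>"
      using eqB[of \<i>] by (simp add: Bi complex_eq_iff)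
    moreover have "B 1 1 + B 1 \<i> + (B \<i> 1 + B \<i> \<i>) = (1 + \<i>) * (T 1 + T \<i>)"
      using eqB[of "1 + \<i>"] by (simp add: B1 B2 linear_add[OF T] add_ac)
    ultimately have "T \<i> = - \<i> * T 1"
      by (simp add: Bi complex_eq_iff)
    then have "B \<i> 1 = \<i> * B 1 1"
      using \<open>B 1 1 = T 1\<close> \<open>B \<i> 1 = - T \<i>\<close> by simp
    then show "transversal u (E (1, u) (0, 1)) = 0"
      by (simp add: E_def transversal_simps B_def)
  qed
  then show ?thesis by (simp add: E_def)
qed

lemma L_J0_left: "L (J 0 h) e = J 0 (L h e)"
proof (rule J0_cases)
  assume "\<And>e. J 0 e = cscale \<i> e"
  then show ?thesis by (simp add: L_cscale_left)
next
  assume "\<And>e. J 0 e = cscale (-\<i>) e"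
  then show ?thesis by (simp add: L_cscale_left cscale_minus_left linear_neg[OF linear_L_left])
qed

text \<open>All derivatives of \<open>X\<close> and \<open>Y\<close> cancel, leaving \<open>L (J X) Y - L (J Y) X + J L(Y) X - J L(X) Y\<close> at the
origin, which vanishes since \<open>L\<close> commutes with \<open>J\<close> in its first argument.\<close>

lemma local_nijenhuis_zero:
  assumes X: "X differentiable (at 0)" and Y: "Y differentiable (at 0)"
  defines "JX \<equiv> \<lambda>z. J z (X z)" and "JY \<equiv> \<lambda>z. J z (Y z)"
  shows "local_bracket JX JY 0 - local_bracket X Y 0
    - J 0 (local_bracket JX Y 0) - J 0 (local_bracket X JY 0) = 0"
proof -
  obtain X' where X': "(X has_derivative X') (at 0)" using X by (auto simp: differentiable_def)
  obtain Y' where Y': "(Y has_derivative Y') (at 0)" using Y by (auto simp: differentiable_def)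
  have dX: "frechet_derivative X (at 0) = X'" and dY: "frechet_derivative Y (at 0) = Y'"
    using frechet_derivative_at[OF X'] frechet_derivative_at[OF Y'] by auto
  have dJX: "frechet_derivative JX (at 0) = (\<lambda>h. L h (X 0) + J 0 (X' h))"
    unfolding JX_def
    using frechet_derivative_at[OF has_derivative_linear_family_apply[OF lin L X']] by simp
  have dJY: "frechet_derivative JY (at 0) = (\<lambda>h. L h (Y 0) + J 0 (Y' h))"
    unfolding JY_def
    using frechet_derivative_at[OF has_derivative_linear_family_apply[OF lin L Y']] by simp
  show ?thesis
    unfolding local_bracket_def dX dY dJX dJY
    by (simp add: JX_def JY_def linear_add[OF linear_J0] linear_diff[OF linear_J0]
        J0_J0 L_J0_left algebra_simps)
qed

end

section \<open>Tangent vectors and brackets on a manifold\<close>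

lemma inv_coord_coord: "inj_on (coord k) (domain k) \<Longrightarrow> q \<in> domain k \<Longrightarrow> inv_coord k (coord k q) = q"
  by (simp add: inv_coord_def)

lemma coord_inv_coord:
  assumes "y \<in> coord k ` domain k"
  shows "coord k (inv_coord k y) = y" "inv_coord k y \<in> domain k"
  using assms by (auto simp: inv_coord_def f_inv_into_f inv_into_into)

lemma tangent_components_related:
  assumes "v \<in> tangent_space A p" "k \<in> charts_at A p" "k' \<in> charts_at A p"
  shows "v k' = coord_diff k k' (\<lambda>q. q) p (v k)"
  using assms unfolding tangent_space_def by blast

text \<open>What the chain rule for coordinate changes at \<open>p\<close> requires of the charts around \<open>p\<close>. It is a pointwise
condition so that it can be verified for the blow-up off the exceptional divisor alone.\<close>
definition compatible_at :: "('a, 'e::real_normed_vector) chart set \<Rightarrow> 'a \<Rightarrow> bool" where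
  "compatible_at A p \<longleftrightarrow>
     (\<forall>k\<in>charts_at A p. inj_on (coord k) (domain k) \<and>
       (\<forall>k'\<in>charts_at A p.
          (\<forall>\<^sub>F y in nhds (coord k p). y \<in> coord k ` (domain k \<inter> domain k')) \<and>
          (\<lambda>z. coord k' (inv_coord k z)) differentiable (at (coord k p))))"

lemma smooth_atlas_compatible_at:
  assumes "smooth_atlas A"
  shows "compatible_at A p"
  unfolding compatible_at_def
proof (intro ballI conjI)
  fix k assume k: "k \<in> charts_at A p"
  then show "inj_on (coord k) (domain k)"
    using assms by (auto simp: charts_at_def smooth_atlas_def is_chart_def)
  fix k' assume k': "k' \<in> charts_at A p"
  have st: "smooth_transition k k'" using assms k k' by (auto simp: charts_at_def smooth_atlas_def)
  have p: "coord k p \<in> coord k ` (domain k \<inter> domain k')" using k k' by (auto simp: charts_at_def)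
  show "\<forall>\<^sub>F y in nhds (coord k p). y \<in> coord k ` (domain k \<inter> domain k')"
    using st p eventually_nhds_in_open by (auto simp: smooth_transition_def)
  show "(\<lambda>z. coord k' (inv_coord k z)) differentiable (at (coord k p))"
    using st p smooth_on_differentiable unfolding smooth_transition_def by blast
qed

context
  fixes A :: "('a, 'e::real_normed_vector) chart set" and p :: 'a
  assumes comp: "compatible_at A p"
begin

lemma compatible_inj: "k \<in> charts_at A p \<Longrightarrow> inj_on (coord k) (domain k)"
  using comp by (auto simp: compatible_at_def)

lemma compatible_inv_coord: "k \<in> charts_at A p \<Longrightarrow> inv_coord k (coord k p) = p"
  using compatible_inj[of k] inv_coord_coord[of k p] by (simp add: charts_at_def)

lemma transition_domain_near:
  assumes "k \<in> charts_at A p" "k' \<in> charts_at A p"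
  shows "\<forall>\<^sub>F y in nhds (coord k p). y \<in> coord k ` (domain k \<inter> domain k')"
  using comp assms by (simp add: compatible_at_def)

lemma transition_has_derivative:
  assumes "k \<in> charts_at A p" "k' \<in> charts_at A p"
  shows "((\<lambda>z. coord k' (inv_coord k z)) has_derivative coord_diff k k' (\<lambda>q. q) p) (at (coord k p))"
  using assms comp unfolding compatible_at_def coord_diff_def frechet_derivative_works[symmetric] by auto

lemma linear_coord_diff:
  assumes "k \<in> charts_at A p" "k' \<in> charts_at A p"
  shows "linear (coord_diff k k' (\<lambda>q. q) p)"
  using has_derivative_linear[OF transition_has_derivative[OF assms]] .

lemma coord_diff_change_source:
  assumes k: "k \<in> charts_at A p" and k': "k' \<in> charts_at A p"
    and diff: "(\<lambda>z. coord l (f (inv_coord k' z))) differentiable (at (coord k' p))"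
  shows "coord_diff k l f p e = coord_diff k' l f p (coord_diff k k' (\<lambda>q. q) p e)"
proof -
  have ev: "\<forall>\<^sub>F y in nhds (coord k p). y \<in> coord k ` (domain k \<inter> domain k')"
    by (rule transition_domain_near[OF k k'])
  have inv: "inv_coord k' (coord k' (inv_coord k y)) = inv_coord k y"
    if "y \<in> coord k ` (domain k \<inter> domain k')" for y
    using that compatible_inj[OF k] compatible_inj[OF k'] by (auto simp: inv_coord_coord)
  have "((\<lambda>z. coord l (f (inv_coord k' (coord k' (inv_coord k z))))) has_derivative
      (\<lambda>e. coord_diff k' l f p (coord_diff k k' (\<lambda>q. q) p e))) (at (coord k p))"
    by (rule has_derivative_compose[OF transition_has_derivative[OF k k']])
      (use diff in \<open>simp add: compatible_inv_coord[OF k] coord_diff_def frechet_derivative_works[symmetric]\<close>)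
  then have "((\<lambda>z. coord l (f (inv_coord k z))) has_derivative
      (\<lambda>e. coord_diff k' l f p (coord_diff k k' (\<lambda>q. q) p e))) (at (coord k p))"
  proof (rule has_derivative_transform_eventually)
    show "\<forall>\<^sub>F z in at (coord k p). coord l (f (inv_coord k' (coord k' (inv_coord k z)))) = coord l (f (inv_coord k z))"
      using ev unfolding eventually_nhds_conv_at by (auto elim!: eventually_mono simp: inv)
  qed (use eventually_nhds_x_imp_x[OF ev] inv in auto)
  from frechet_derivative_at[OF this] show ?thesis by (simp add: coord_diff_def fun_eq_iff)
qed

lemma coord_diff_cocycle:
  assumes k: "k \<in> charts_at A p" and k': "k' \<in> charts_at A p" and k'': "k'' \<in> charts_at A p"
  shows "coord_diff k k'' (\<lambda>q. q) p e = coord_diff k' k'' (\<lambda>q. q) p (coord_diff k k' (\<lambda>q. q) p e)"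
  by (rule coord_diff_change_source[OF k k']) (rule differentiableI[OF transition_has_derivative[OF k' k'']])

lemma coord_diff_self:
  assumes k: "k \<in> charts_at A p"
  shows "coord_diff k k (\<lambda>q. q) p e = e"
proof -
  have ev: "\<forall>\<^sub>F y in nhds (coord k p). y \<in> coord k ` domain k"
    using transition_domain_near[OF k k] by simp
  have "((\<lambda>z. z) has_derivative (\<lambda>e. e)) (at (coord k p))" by simp
  then have "((\<lambda>z. coord k (inv_coord k z)) has_derivative (\<lambda>e. e)) (at (coord k p))"
  proof (rule has_derivative_transform_eventually)
    show "\<forall>\<^sub>F z in at (coord k p). z = coord k (inv_coord k z)"
      using ev unfolding eventually_nhds_conv_at
      by (auto elim!: eventually_mono simp: coord_inv_coord(1))
  qed (use k in \<open>auto simp: compatible_inv_coord\<close>)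
  from frechet_derivative_at[OF this] show ?thesis by (simp add: coord_diff_def fun_eq_iff)
qed

lemma tvec_of_tangent:
  assumes k: "k \<in> charts_at A p"
  shows "tvec_of A k p e \<in> tangent_space A p"
  by (auto simp: tangent_space_def tvec_of_def k intro: coord_diff_cocycle[OF k])

lemma tvec_of_component:
  assumes "k \<in> charts_at A p"
  shows "tvec_of A k p e k = e"
  using assms by (simp add: tvec_of_def coord_diff_self)

lemma tangent_eq_tvec_of:
  assumes v: "v \<in> tangent_space A p" and k: "k \<in> charts_at A p"
  shows "v = tvec_of A k p (v k)"
proof
  fix l
  have "v l = coord_diff k l (\<lambda>q. q) p (v k)" if "l \<in> charts_at A p"
    by (rule tangent_components_related[OF v k that])
  moreover have "v l = 0" if "l \<notin> charts_at A p"
    using v that unfolding tangent_space_def by blast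
  ultimately show "v l = tvec_of A k p (v k) l"
    unfolding tvec_of_def by presburger
qed

lemma tvec_of_add:
  assumes "k \<in> charts_at A p"
  shows "tvec_of A k p (e + e') = (\<lambda>l. tvec_of A k p e l + tvec_of A k p e' l)"
  using linear_add[OF linear_coord_diff[OF assms]] by (auto simp: tvec_of_def)

lemma tvec_of_scale:
  assumes "k \<in> charts_at A p"
  shows "tvec_of A k p (c *\<^sub>R e) = (\<lambda>l. c *\<^sub>R tvec_of A k p e l)"
  using linear_scale[OF linear_coord_diff[OF assms]] by (auto simp: tvec_of_def)

text \<open>The differential is defined through one chosen chart at \<open>p\<close>; by the chain rule any chart computes it.\<close>

lemma differential_component:
  assumes k: "k \<in> charts_at A p" and v: "v \<in> tangent_space A p" and l: "l \<in> charts_at B (f p)"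
    and f: "\<And>k. k \<in> charts_at A p \<Longrightarrow> (\<lambda>z. coord l (f (inv_coord k z))) differentiable (at (coord k p))"
  shows "differential A B f p v l = coord_diff k l f p (v k)"
proof -
  define k0 where "k0 = (SOME k. k \<in> charts_at A p)"
  have k0: "k0 \<in> charts_at A p" unfolding k0_def using k by (rule someI)
  have "differential A B f p v l = coord_diff k0 l f p (v k0)"
    using l by (simp add: differential_def k0_def Let_def)
  also have "\<dots> = coord_diff k l f p (coord_diff k0 k (\<lambda>q. q) p (v k0))"
    by (rule coord_diff_change_source[OF k0 k f[OF k]])
  also have "coord_diff k0 k (\<lambda>q. q) p (v k0) = v k"
    by (rule tangent_components_related[OF v k0 k, symmetric])
  finally show ?thesis .
qed

end

lemma smooth_map_differentiable:
  assumes "smooth_map A B f" "k \<in> charts_at A p" "l \<in> charts_at B (f p)"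
  shows "(\<lambda>z. coord l (f (inv_coord k z))) differentiable (at (coord k p))"
  using assms by (intro smooth_on_differentiable[of _ "coord k ` (domain k \<inter> f -` domain l)"])
    (auto simp: smooth_map_def charts_at_def)

lemma differential_tangent:
  fixes A :: "('a, 'e::real_normed_vector) chart set" and B :: "('b, 'f::real_normed_vector) chart set"
  assumes A: "compatible_at A p" and p: "p \<in> points A" and B: "compatible_at B (f p)"
    and f: "smooth_map A B f"
  shows "differential A B f p v \<in> tangent_space B (f p)"
proof -
  define k where "k = (SOME k. k \<in> charts_at A p)"
  have k: "k \<in> charts_at A p" unfolding k_def
    by (rule someI_ex) (use p in \<open>auto simp: points_def charts_at_def\<close>)
  have *: "coord_diff k l' f p e = coord_diff l l' (\<lambda>q. q) (f p) (coord_diff k l f p e)"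
    if l: "l \<in> charts_at B (f p)" and l': "l' \<in> charts_at B (f p)" for l l' e
  proof -
    have "open (coord k ` (domain k \<inter> f -` domain l))" "coord k p \<in> coord k ` (domain k \<inter> f -` domain l)"
      using f k l by (auto simp: smooth_map_def charts_at_def)
    then have ev: "\<forall>\<^sub>F y in nhds (coord k p). y \<in> coord k ` (domain k \<inter> f -` domain l)"
      by (rule eventually_nhds_in_open)
    have inv: "inv_coord l (coord l (f (inv_coord k y))) = f (inv_coord k y)"
      if "y \<in> coord k ` (domain k \<inter> f -` domain l)" for y
      using that compatible_inj[OF A k] compatible_inj[OF B l] by (auto simp: inv_coord_coord)
    have 1: "((\<lambda>z. coord l (f (inv_coord k z))) has_derivative coord_diff k l f p) (at (coord k p))"
      using smooth_map_differentiable[OF f k l] by (simp add: coord_diff_def frechet_derivative_works[symmetric])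
    have 2: "((\<lambda>z. coord l' (inv_coord l z)) has_derivative coord_diff l l' (\<lambda>q. q) (f p))
        (at (coord l (f (inv_coord k (coord k p)))))"
      using transition_has_derivative[OF B l l'] by (simp add: compatible_inv_coord[OF A k])
    have "((\<lambda>z. coord l' (inv_coord l (coord l (f (inv_coord k z))))) has_derivative
        (\<lambda>e. coord_diff l l' (\<lambda>q. q) (f p) (coord_diff k l f p e))) (at (coord k p))"
      using has_derivative_compose[OF 1 2] .
    then have "((\<lambda>z. coord l' (f (inv_coord k z))) has_derivative
        (\<lambda>e. coord_diff l l' (\<lambda>q. q) (f p) (coord_diff k l f p e))) (at (coord k p))"
    proof (rule has_derivative_transform_eventually)
      show "\<forall>\<^sub>F z in at (coord k p). coord l' (inv_coord l (coord l (f (inv_coord k z)))) = coord l' (f (inv_coord k z))"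
        using ev unfolding eventually_nhds_conv_at by (auto elim!: eventually_mono simp: inv)
    qed (use eventually_nhds_x_imp_x[OF ev] inv in auto)
    from frechet_derivative_at[OF this] show ?thesis by (simp add: coord_diff_def fun_eq_iff)
  qed
  show ?thesis
    unfolding tangent_space_def differential_def k_def[symmetric] Let_def by (auto intro: *)
qed

definition end_component ::
  "('a, 'e::real_normed_vector) chart set \<Rightarrow> ('a \<Rightarrow> ('a, 'e) tvec \<Rightarrow> ('a, 'e) tvec) \<Rightarrow>
   ('a, 'e) chart \<Rightarrow> 'e \<Rightarrow> 'e \<Rightarrow> 'e" where
  "end_component A J k y e = J (inv_coord k y) (tvec_of A k (inv_coord k y) e) k"

lemma end_component_apply:
  assumes "compatible_at A p" "k \<in> charts_at A p" "v \<in> tangent_space A p"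
  shows "J p v k = end_component A J k (coord k p) (v k)"
  unfolding end_component_def compatible_inv_coord[OF assms(1,2)]
    tangent_eq_tvec_of[OF assms(1,3,2), symmetric] ..

lemma
  assumes J: "almost_complex_structure A J" and comp: "compatible_at A p" and k: "k \<in> charts_at A p"
  shows linear_end_component: "linear (end_component A J k (coord k p))"
    and end_component_square: "end_component A J k (coord k p) (end_component A J k (coord k p) e) = - e"
    and acs_tangent: "v \<in> tangent_space A p \<Longrightarrow> J p v \<in> tangent_space A p"
proof -
  note inv = compatible_inv_coord[OF comp k] and tan = tvec_of_tangent[OF comp k]
  have p: "p \<in> points A" using k by (auto simp: charts_at_def points_def)
  have Jt: "J p v \<in> tangent_space A p" "J p (\<lambda>k. c *\<^sub>R v k) = (\<lambda>k. c *\<^sub>R J p v k)"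
    "J p (J p v) = (\<lambda>k. - v k)" if "v \<in> tangent_space A p" for v c
    using J p that by (auto simp: almost_complex_structure_def smooth_endomorphism_def)
  have Jadd: "J p (\<lambda>k. v k + w k) = (\<lambda>k. J p v k + J p w k)"
    if "v \<in> tangent_space A p" "w \<in> tangent_space A p" for v w
    using J p that by (auto simp: almost_complex_structure_def smooth_endomorphism_def)
  show "linear (end_component A J k (coord k p))"
    by (rule linearI) (simp_all add: end_component_def inv tvec_of_add[OF comp k]
        tvec_of_scale[OF comp k] Jt(2) Jadd tan)
  show "J p v \<in> tangent_space A p" if "v \<in> tangent_space A p"
    using Jt(1)[OF that] .
  have "end_component A J k (coord k p) (end_component A J k (coord k p) e) = J p (J p (tvec_of A k p e)) k"
    unfolding end_component_apply[OF comp k Jt(1)[OF tan]]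
    by (simp add: end_component_def inv)
  then show "end_component A J k (coord k p) (end_component A J k (coord k p) e) = - e"
    by (simp add: Jt(3)[OF tan] tvec_of_component[OF comp k])
qed

lemma smooth_end_component:
  assumes "almost_complex_structure A J" "k \<in> A"
  shows "smooth_on (\<lambda>y. end_component A J k y e) (coord k ` domain k)"
  using assms by (simp add: almost_complex_structure_def smooth_endomorphism_def end_component_def)

text \<open>Brackets of \<open>J X\<close> need no more than differentiability of its components, and this follows from the
product rule at once.\<close>
definition differentiable_field :: "('a, 'e::real_normed_vector) chart set \<Rightarrow> ('a \<Rightarrow> ('a, 'e) tvec) \<Rightarrow> bool" where
  "differentiable_field A X \<longleftrightarrow> (\<forall>p\<in>points A. X p \<in> tangent_space A p) \<and>
     (\<forall>k\<in>A. \<forall>y\<in>coord k ` domain k. (\<lambda>z. X (inv_coord k z) k) differentiable (at y))"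

lemma smooth_vector_field_differentiable: "smooth_vector_field A X \<Longrightarrow> differentiable_field A X"
  unfolding smooth_vector_field_def differentiable_field_def by (meson smooth_on_differentiable)

lemma acs_field_component:
  fixes A :: "('a, 'e::real_normed_vector) chart set"
  assumes A: "smooth_atlas A" and X: "differentiable_field A X" and k: "k \<in> A" and y: "y \<in> coord k ` domain k"
  shows "J (inv_coord k y) (X (inv_coord k y)) k = end_component A J k y (X (inv_coord k y) k)"
proof -
  have "k \<in> charts_at A (inv_coord k y)" using k coord_inv_coord[OF y] by (simp add: charts_at_def)
  moreover from this have "X (inv_coord k y) \<in> tangent_space A (inv_coord k y)"
    using X by (auto simp: differentiable_field_def charts_at_def points_def)
  ultimately show ?thesis
    using end_component_apply[OF smooth_atlas_compatible_at[OF A], of k "inv_coord k y"]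
    by (simp add: coord_inv_coord[OF y])
qed

lemma end_component_on_chart:
  assumes A: "smooth_atlas A" and J: "almost_complex_structure A J" and k: "k \<in> A" and y: "y \<in> coord k ` domain k"
  shows "linear (end_component A J k y)" "end_component A J k y (end_component A J k y e) = - e"
proof -
  have "k \<in> charts_at A (inv_coord k y)" using k coord_inv_coord[OF y] by (simp add: charts_at_def)
  from linear_end_component[OF J smooth_atlas_compatible_at[OF A] this]
    end_component_square[OF J smooth_atlas_compatible_at[OF A] this]
  show "linear (end_component A J k y)" "end_component A J k y (end_component A J k y e) = - e"
    by (simp_all add: coord_inv_coord[OF y])
qed

lemma acs_field_differentiable:
  fixes A :: "('a, 'e::euclidean_space) chart set"
  assumes A: "smooth_atlas A" and J: "almost_complex_structure A J" and X: "differentiable_field A X"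
  shows "differentiable_field A (\<lambda>q. J q (X q))"
  unfolding differentiable_field_def
proof (intro conjI ballI)
  fix p assume p: "p \<in> points A"
  then obtain k where k: "k \<in> charts_at A p" by (auto simp: points_def charts_at_def)
  show "J p (X p) \<in> tangent_space A p"
    using X p by (intro acs_tangent[OF J smooth_atlas_compatible_at[OF A] k])
      (auto simp: differentiable_field_def)
next
  fix k y assume k: "k \<in> A" and y: "y \<in> coord k ` domain k"
  have op: "open (coord k ` domain k)" using A k by (auto simp: smooth_atlas_def is_chart_def)
  have ev: "\<forall>\<^sub>F z in nhds y. z \<in> coord k ` domain k" by (rule eventually_nhds_in_open[OF op y])
  have lin: "\<forall>\<^sub>F z in nhds y. linear (end_component A J k z)"
    using ev by eventually_elim (rule end_component_on_chart[OF A J k])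
  have "(\<lambda>z. end_component A J k z e) differentiable (at y)" for e
    by (rule smooth_on_differentiable[OF smooth_end_component[OF J k] y])
  then have d: "((\<lambda>z. end_component A J k z e) has_derivative
      (\<lambda>h. frechet_derivative (\<lambda>z. end_component A J k z e) (at y) h)) (at y)" for e
    by (simp add: frechet_derivative_works[symmetric])
  obtain X' where X': "((\<lambda>z. X (inv_coord k z) k) has_derivative X') (at y)"
    using X k y unfolding differentiable_field_def differentiable_def by blast
  have "((\<lambda>z. J (inv_coord k z) (X (inv_coord k z)) k) has_derivative
      (\<lambda>h. frechet_derivative (\<lambda>z. end_component A J k z (X (inv_coord k y) k)) (at y) h +
        end_component A J k y (X' h))) (at y)"
    by (rule has_derivative_transform_within_open[OF has_derivative_linear_family_apply[OF lin d X'] op y])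
      (rule acs_field_component[OF A X k, symmetric])
  then show "(\<lambda>z. J (inv_coord k z) (X (inv_coord k z)) k) differentiable (at y)"
    by (rule differentiableI)
qed

lemma lie_bracket_component:
  assumes "compatible_at A p" "k \<in> charts_at A p"
  shows "lie_bracket A X Y p k =
    local_bracket (\<lambda>z. X (inv_coord k z) k) (\<lambda>z. Y (inv_coord k z) k) (coord k p)"
  using assms by (simp add: lie_bracket_def local_bracket_def compatible_inv_coord[OF assms])

text \<open>Tangency matters because an endomorphism \<open>J p\<close> is linear and determined by its matrix only on the
tangent space, and the Nijenhuis tensor applies \<open>J p\<close> to brackets.\<close>

lemma lie_bracket_tangent:
  fixes A :: "('a, 'e::euclidean_space) chart set"
  assumes A: "smooth_atlas A" and X: "differentiable_field A X" and Y: "differentiable_field A Y"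
  shows "lie_bracket A X Y p \<in> tangent_space A p"
proof -
  note comp = smooth_atlas_compatible_at[OF A]
  have *: "lie_bracket A X Y p k' = coord_diff k k' (\<lambda>q. q) p (lie_bracket A X Y p k)"
    if k: "k \<in> charts_at A p" and k': "k' \<in> charts_at A p" for k k'
  proof -
    define \<theta> where "\<theta> = (\<lambda>z. coord k' (inv_coord k z))"
    define S where "S = coord k ` (domain k \<inter> domain k')"
    have kA: "k \<in> A" "k' \<in> A" and pk: "p \<in> domain k" "p \<in> domain k'"
      using k k' by (auto simp: charts_at_def)
    have S: "open S" "coord k p \<in> S" and sm: "smooth_on \<theta> S"
      using A kA pk unfolding smooth_atlas_def smooth_transition_def S_def \<theta>_def by auto
    have \<theta>p: "\<theta> (coord k p) = coord k' p" by (simp add: \<theta>_def compatible_inv_coord[OF comp k])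
    have rel: "Z (inv_coord k' (\<theta> z)) k' = frechet_derivative \<theta> (at z) (Z (inv_coord k z) k)"
      if Z: "differentiable_field A Z" and z: "z \<in> S" for Z z
    proof -
      obtain q where q: "q \<in> domain k" "q \<in> domain k'" "z = coord k q" using z by (auto simp: S_def)
      have kq: "k \<in> charts_at A q" "k' \<in> charts_at A q" using q kA by (auto simp: charts_at_def)
      have "Z q \<in> tangent_space A q" using Z q kA by (auto simp: differentiable_field_def points_def)
      then have "Z q k' = coord_diff k k' (\<lambda>q. q) q (Z q k)" by (rule tangent_components_related[OF _ kq])
      then show ?thesis
        using compatible_inv_coord[OF comp kq(1)] compatible_inv_coord[OF comp kq(2)]
        by (simp add: \<theta>_def coord_diff_def q(3))
    qed
    have ev: "\<forall>\<^sub>F z in nhds (coord k p). z \<in> S" by (rule eventually_nhds_in_open[OF S])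
    have dif: "(\<lambda>z. Z (inv_coord l z) l) differentiable (at (coord l p))"
      if "differentiable_field A Z" "l \<in> charts_at A p" for Z l
      using that by (auto simp: differentiable_field_def charts_at_def)
    have "local_bracket (\<lambda>z. X (inv_coord k' z) k') (\<lambda>z. Y (inv_coord k' z) k') (\<theta> (coord k p)) =
        frechet_derivative \<theta> (at (coord k p))
          (local_bracket (\<lambda>z. X (inv_coord k z) k) (\<lambda>z. Y (inv_coord k z) k) (coord k p))"
    proof (rule bracket_of_related_fields)
      show "Ck_on (Suc (Suc 0)) \<theta> S" using sm unfolding smooth_on_def by blast
      show "\<forall>\<^sub>F z in nhds (coord k p). X (inv_coord k' (\<theta> z)) k' = frechet_derivative \<theta> (at z) (X (inv_coord k z) k)"
        using ev by eventually_elim (rule rel[OF X])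
      show "\<forall>\<^sub>F z in nhds (coord k p). Y (inv_coord k' (\<theta> z)) k' = frechet_derivative \<theta> (at z) (Y (inv_coord k z) k)"
        using ev by eventually_elim (rule rel[OF Y])
    qed (use S dif[OF X] dif[OF Y] k k' in \<open>simp_all add: \<theta>p\<close>)
    then show ?thesis
      by (simp add: lie_bracket_component[OF comp k] lie_bracket_component[OF comp k'] coord_diff_def
          flip: \<theta>_def \<theta>p)
  qed
  show ?thesis
    unfolding tangent_space_def
  proof (intro CollectI conjI ballI allI impI)
    show "lie_bracket A X Y p k = 0" if "k \<notin> charts_at A p" for k
      using that by (simp add: lie_bracket_def)
  qed (rule *)
qed

section \<open>The smooth structure of the blow-up\<close>

text \<open>The chart \<open>k\<close> and the parametrization \<open>\<Phi>\<close> are related by mutually inverse coordinate changes, \<open>coord k \<circ> \<Phi>\<close> and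
\<open>F\<close>, differentiable at the coordinates of \<open>\<Phi> z0\<close>. Transitions between two such charts
factor through \<open>\<Phi>\<close>, so each chart has to be examined only once.\<close>
definition parametrized_at ::
  "('a, 'e::real_normed_vector) chart \<Rightarrow> ('f::real_normed_vector \<Rightarrow> 'a) \<Rightarrow> 'f \<Rightarrow> bool" where
  "parametrized_at k \<Phi> z0 \<longleftrightarrow>
     inj_on (coord k) (domain k) \<and> (\<forall>\<^sub>F z in nhds z0. \<Phi> z \<in> domain k) \<and>
     (\<lambda>z. coord k (\<Phi> z)) differentiable (at z0) \<and>
     (\<exists>F. F differentiable (at (coord k (\<Phi> z0))) \<and> F (coord k (\<Phi> z0)) = z0 \<and>
       (\<forall>\<^sub>F y in nhds (coord k (\<Phi> z0)). y \<in> coord k ` domain k \<and> inv_coord k y = \<Phi> (F y)))"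

lemma compatible_at_if_parametrized:
  assumes param: "\<And>k. k \<in> charts_at A (\<Phi> z0) \<Longrightarrow> parametrized_at k \<Phi> z0"
  shows "compatible_at A (\<Phi> z0)"
  unfolding compatible_at_def
proof (intro ballI conjI)
  fix k assume k: "k \<in> charts_at A (\<Phi> z0)"
  show "inj_on (coord k) (domain k)" using param[OF k] by (simp add: parametrized_at_def)
  fix k' assume k': "k' \<in> charts_at A (\<Phi> z0)"
  let ?y0 = "coord k (\<Phi> z0)"
  obtain F where F: "F differentiable (at ?y0)" "F ?y0 = z0"
    and ev: "\<forall>\<^sub>F y in nhds ?y0. y \<in> coord k ` domain k \<and> inv_coord k y = \<Phi> (F y)"
    using param[OF k] by (auto simp: parametrized_at_def)
  have dom': "\<forall>\<^sub>F z in nhds z0. \<Phi> z \<in> domain k'"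
    and d': "(\<lambda>z. coord k' (\<Phi> z)) differentiable (at z0)"
    using param[OF k'] by (auto simp: parametrized_at_def)
  have "isCont F ?y0" using F(1) differentiable_imp_continuous_within by blast
  then have "filterlim F (nhds z0) (nhds ?y0)"
    using F(2) by (metis isCont_def tendsto_at_iff_tendsto_nhds)
  then have "\<forall>\<^sub>F y in nhds ?y0. \<Phi> (F y) \<in> domain k'"
    using dom' unfolding filterlim_iff by blast
  with ev show "\<forall>\<^sub>F y in nhds ?y0. y \<in> coord k ` (domain k \<inter> domain k')"
  proof eventually_elim
    case (elim y)
    then show ?case
      using coord_inv_coord[of y k] by (intro image_eqI[of _ _ "inv_coord k y"]) auto
  qed
  have "(\<lambda>y. coord k' (\<Phi> (F y))) differentiable (at ?y0)"
    using differentiable_chain_at[OF F(1)] d' F(2) by (simp add: o_def)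
  then obtain D where D: "((\<lambda>y. coord k' (\<Phi> (F y))) has_derivative D) (at ?y0)"
    by (auto simp: differentiable_def)
  have "((\<lambda>y. coord k' (inv_coord k y)) has_derivative D) (at ?y0)"
  proof (rule has_derivative_transform_eventually[OF D])
    show "\<forall>\<^sub>F y in at ?y0. coord k' (\<Phi> (F y)) = coord k' (inv_coord k y)"
      using ev unfolding eventually_nhds_conv_at by (auto elim!: eventually_mono)
    show "coord k' (\<Phi> (F ?y0)) = coord k' (inv_coord k ?y0)"
      using eventually_nhds_x_imp_x[OF ev] by simp
  qed simp
  then show "(\<lambda>y. coord k' (inv_coord k y)) differentiable (at ?y0)" by (rule differentiableI)
qed

lemma
  assumes "inj_on \<psi> V"
  shows domain_chart_of_param [simp]: "domain (chart_of_param V \<psi>) = \<psi> ` V"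
    and coord_chart_of_param: "y \<in> V \<Longrightarrow> coord (chart_of_param V \<psi>) (\<psi> y) = y"
    and inj_coord_chart_of_param: "inj_on (coord (chart_of_param V \<psi>)) (\<psi> ` V)"
    and inv_coord_chart_of_param: "y \<in> V \<Longrightarrow> inv_coord (chart_of_param V \<psi>) y = \<psi> y"
proof -
  show "domain (chart_of_param V \<psi>) = \<psi> ` V" by (simp add: chart_of_param_def)
  show c: "coord (chart_of_param V \<psi>) (\<psi> y) = y" if "y \<in> V" for y
    using assms that by (simp add: chart_of_param_def)
  show inj: "inj_on (coord (chart_of_param V \<psi>)) (\<psi> ` V)"
    using c by (auto simp: inj_on_def)
  show "inv_coord (chart_of_param V \<psi>) y = \<psi> y" if "y \<in> V"
    using inv_coord_coord[of "chart_of_param V \<psi>" "\<psi> y"] inj c[OF that] that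
    by (simp add: chart_of_param_def)
qed

locale blowup_setting =
  fixes M :: "('a, C2) chart set" and x :: 'a and U :: "C2 set" and \<phi> :: "C2 \<Rightarrow> 'a"
  assumes atlas: "smooth_atlas M" and loc: "local_chart_at M x U \<phi>"
begin

lemma local_chart: "open U" "0 \<in> U" "inj_on \<phi> U" "\<phi> ` U \<subseteq> points M" "\<phi> 0 = x"
  using loc by (auto simp: local_chart_at_def)

lemma \<phi>_off_center: "z \<in> U \<Longrightarrow> z \<noteq> 0 \<Longrightarrow> \<phi> z \<in> points M - {x}"
  using local_chart by (metis DiffI image_subset_iff inj_on_contraD singletonD)

definition param_domain :: "('a, C2) chart \<Rightarrow> C2 set" where
  "param_domain k = {z \<in> U. \<phi> z \<in> domain k}"

definition from_param :: "('a, C2) chart \<Rightarrow> C2 \<Rightarrow> C2" where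
  "from_param k z = coord k (\<phi> z)"

definition to_param :: "('a, C2) chart \<Rightarrow> C2 \<Rightarrow> C2" where
  "to_param k y = inv_into U \<phi> (inv_coord k y)"

lemma inj_coord: "k \<in> M \<Longrightarrow> inj_on (coord k) (domain k)"
  using atlas by (auto simp: smooth_atlas_def is_chart_def)

lemma
  assumes k: "k \<in> M"
  shows open_param_domain: "open (param_domain k)"
    and smooth_from_param: "Ck_on n (from_param k) (param_domain k)"
    and open_from_param_image: "open (from_param k ` param_domain k)"
    and smooth_to_param: "smooth_on (to_param k) (from_param k ` param_domain k)"
proof -
  let ?c = "chart_of_param U \<phi>"
  have st: "smooth_transition ?c k" "smooth_transition k ?c"
    using loc k by (auto simp: local_chart_at_def)
  have im: "coord ?c ` (domain ?c \<inter> domain k) = param_domain k"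
    using local_chart(3) by (force simp: param_domain_def coord_chart_of_param image_iff)
  show op: "open (param_domain k)" using st(1) im by (simp add: smooth_transition_def)
  have "Ck_on n (\<lambda>z. coord k (inv_coord ?c z)) (param_domain k)"
    using st(1) im by (simp add: smooth_transition_def smooth_on_def)
  then show "Ck_on n (from_param k) (param_domain k)"
    by (rule Ck_on_cong_open[OF _ op]) (use local_chart(3) in \<open>auto simp: from_param_def param_domain_def inv_coord_chart_of_param\<close>)
  have im': "coord k ` (domain k \<inter> domain ?c) = from_param k ` param_domain k"
    using local_chart(3) by (force simp: param_domain_def from_param_def image_iff)
  then show "open (from_param k ` param_domain k)" using st(2) by (simp add: smooth_transition_def)
  show "smooth_on (to_param k) (from_param k ` param_domain k)"
    using st(2) im' by (simp add: smooth_transition_def to_param_def[abs_def] chart_of_param_def)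
qed

lemma to_param_from_param:
  assumes "k \<in> M" "z \<in> param_domain k"
  shows "to_param k (from_param k z) = z" "inv_coord k (from_param k z) = \<phi> z"
  using assms local_chart(3) inj_coord[OF assms(1)]
  by (auto simp: to_param_def from_param_def param_domain_def inv_coord_coord)

lemma from_param_has_derivative:
  assumes "k \<in> M" "z \<in> param_domain k"
  shows "(from_param k has_derivative frechet_derivative (from_param k) (at z)) (at z)"
  using smooth_from_param[OF assms(1), of "Suc 0"] assms(2) by (simp add: frechet_derivative_works[symmetric])

lemma to_param_has_derivative:
  assumes "k \<in> M" "z \<in> param_domain k"
  shows "(to_param k has_derivative frechet_derivative (to_param k) (at (from_param k z))) (at (from_param k z))"
  using smooth_on_differentiable[OF smooth_to_param[OF assms(1)]] assms(2) by (simp add: frechet_derivative_works[symmetric])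

text \<open>On \<open>U - {0}\<close>, a parametrization of a punctured neighbourhood of the exceptional divisor.\<close>
definition off_divisor :: "C2 \<Rightarrow> ('a + C2 \<times> C2 set) set" where
  "off_divisor z = blowup_class M x U \<phi> (Inl (\<phi> z))"

lemma off_divisor_eq:
  assumes "z \<in> U" "z \<noteq> 0"
  shows "off_divisor z = blowup_class M x U \<phi> (Inr (z, complex_line z))"
  unfolding off_divisor_def blowup_class_def
  by (rule equiv_class_eq[OF equiv_blowup_rel[OF loc]])
    (use assms in \<open>auto simp: blowup_rel_def blowup_glue_def simp del: split_paired_Ex split_paired_All\<close>)

lemma proj_off_divisor:
  assumes "z \<in> U" "z \<noteq> 0"
  shows "blowup_proj \<phi> (off_divisor z) = \<phi> z"
  unfolding off_divisor_def using blowup_proj_class(1)[OF loc \<phi>_off_center[OF assms]] .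

lemma blowup_class_Inr_inj:
  assumes r: "r \<in> local_blowup U" and eq: "blowup_class M x U \<phi> (Inr r) = blowup_class M x U \<phi> (Inr r')"
  shows "r = r'"
proof -
  have "Inr r \<in> blowup_class M x U \<phi> (Inr r)"
    using r by (auto simp: blowup_class_def blowup_rel_def blowup_sum_def)
  then have "Inr r \<in> blowup_class M x U \<phi> (Inr r')" using eq by simp
  then show ?thesis by (auto simp: blowup_class_def blowup_rel_def blowup_glue_def)
qed

text \<open>In a chart of \<open>M\<close> with the centre removed, \<open>off_divisor\<close> looks like \<open>\<phi>\<close>, so the coordinate
changes between \<open>\<phi>\<close> and the atlas of \<open>M\<close> serve.\<close>

lemma restricted_chart_parametrized:
  assumes k: "k \<in> M" and z0: "z0 \<in> U" "z0 \<noteq> 0"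
    and c: "c = Chart ((\<lambda>y. blowup_class M x U \<phi> (Inl y)) ` (domain k - {x})) (\<lambda>q. coord k (blowup_proj \<phi> q))"
    and dom: "off_divisor z0 \<in> domain c"
  shows "parametrized_at c off_divisor z0"
proof -
  have proj: "blowup_proj \<phi> (blowup_class M x U \<phi> (Inl y)) = y" if "y \<in> domain k - {x}" for y
    using that k by (intro blowup_proj_class(1)[OF loc]) (auto simp: points_def)
  have inj: "inj_on (coord c) (domain c)"
    using inj_coord[OF k] by (auto simp: c inj_on_def proj)
  obtain y where y: "y \<in> domain k - {x}" "off_divisor z0 = blowup_class M x U \<phi> (Inl y)"
    using dom by (auto simp: c)
  then have "\<phi> z0 = y" using proj_off_divisor[OF z0] proj[OF y(1)] by simp
  then have z0k: "z0 \<in> param_domain k" using y z0 by (simp add: param_domain_def)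
  define S where "S = param_domain k - {0}"
  have S: "open S" "z0 \<in> S" using open_param_domain[OF k] z0k z0 by (auto simp: S_def)
  have memS: "off_divisor z \<in> domain c" "coord c (off_divisor z) = from_param k z" if "z \<in> S" for z
    using that \<phi>_off_center[of z] proj_off_divisor[of z]
    by (auto simp: S_def param_domain_def off_divisor_def c from_param_def)
  have ev: "\<forall>\<^sub>F z in nhds z0. z \<in> S" by (rule eventually_nhds_in_open[OF S])
  have der: "((\<lambda>z. coord c (off_divisor z)) has_derivative frechet_derivative (from_param k) (at z0)) (at z0)"
    by (rule has_derivative_transform_within_open[OF from_param_has_derivative[OF k z0k] S])
      (simp add: memS)
  have F: "to_param k differentiable (at (from_param k z0))" "to_param k (from_param k z0) = z0"
    using to_param_has_derivative[OF k z0k] differentiableI to_param_from_param[OF k z0k] by blast+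
  have cont: "isCont (to_param k) (from_param k z0)"
    using F(1) differentiable_imp_continuous_within by blast
  have "\<forall>\<^sub>F y in nhds (from_param k z0). y \<in> from_param k ` param_domain k"
    by (rule eventually_nhds_in_open[OF open_from_param_image[OF k]]) (use z0k in auto)
  moreover have "\<forall>\<^sub>F y in nhds (from_param k z0). to_param k y \<noteq> 0"
  proof -
    have "filterlim (to_param k) (nhds z0) (nhds (from_param k z0))"
      using cont F(2) by (metis isCont_def tendsto_at_iff_tendsto_nhds)
    moreover have "\<forall>\<^sub>F z in nhds z0. z \<noteq> 0" using z0(2) by (simp add: t1_space_nhds)
    ultimately show ?thesis unfolding filterlim_iff by blast
  qed
  ultimately have "\<forall>\<^sub>F y in nhds (from_param k z0). y \<in> coord c ` domain c \<and> inv_coord c y = off_divisor (to_param k y)"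
  proof eventually_elim
    case (elim y)
    then obtain z where z: "z \<in> param_domain k" "y = from_param k z" by blast
    then have "z \<in> S" using elim to_param_from_param(1)[OF k z(1)] by (auto simp: S_def)
    then show ?case
      using memS[of z] z inv_coord_coord[OF inj, of "off_divisor z"] to_param_from_param(1)[OF k z(1)]
      by (metis image_eqI)
  qed
  moreover have "\<forall>\<^sub>F z in nhds z0. off_divisor z \<in> domain c"
    using ev by eventually_elim (rule memS)
  ultimately show ?thesis
    unfolding parametrized_at_def using inj der F memS(2)[OF S(2)]
    by (auto intro: differentiableI)
qed

text \<open>A common treatment of the two standard charts of the blow-up: \<open>F\<close> is the blow-down in the chart, \<open>l\<close> the
line coordinate, \<open>D\<close> the set where one coordinate of \<open>\<complex>\<^sup>2\<close> is nonzero, and \<open>G\<close> the rational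
inverse of \<open>F\<close> on \<open>D\<close>.\<close>

lemma standard_chart_parametrized:
  fixes F G :: "C2 \<Rightarrow> C2" and l :: "C2 \<Rightarrow> C2 set" and D :: "C2 set"
  defines "\<psi> \<equiv> \<lambda>y. blowup_class M x U \<phi> (Inr (F y, l y))" and "V \<equiv> {y. F y \<in> U}"
  assumes mem: "\<And>y. y \<in> V \<Longrightarrow> (F y, l y) \<in> local_blowup U"
    and line: "\<And>y. F y \<noteq> 0 \<Longrightarrow> l y = complex_line (F y)"
    and inj: "\<And>y y'. F y = F y' \<Longrightarrow> l y = l y' \<Longrightarrow> y = y'"
    and D: "open D" "0 \<notin> D" "\<And>y. F y \<noteq> 0 \<Longrightarrow> F y \<in> D"
    and F: "\<And>y. F differentiable (at y)"
    and G: "\<And>z. z \<in> D \<Longrightarrow> G differentiable (at z)" "\<And>z. z \<in> D \<Longrightarrow> F (G z) = z"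
    and z0: "z0 \<in> U" "z0 \<noteq> 0" and dom: "off_divisor z0 \<in> domain (chart_of_param V \<psi>)"
  shows "parametrized_at (chart_of_param V \<psi>) off_divisor z0"
proof -
  have injV: "inj_on \<psi> V"
    using blowup_class_Inr_inj[OF mem] inj unfolding \<psi>_def inj_on_def by blast
  note chart = domain_chart_of_param[OF injV] coord_chart_of_param[OF injV]
    inj_coord_chart_of_param[OF injV] inv_coord_chart_of_param[OF injV]
  have off: "off_divisor (F y) = \<psi> y" if "y \<in> V" "F y \<noteq> 0" for y
    using off_divisor_eq[of "F y"] that line[of y] by (simp add: \<psi>_def V_def)
  have GF: "G (F y) = y" if "F y \<noteq> 0" for y
  proof (rule inj)
    show eq: "F (G (F y)) = F y" by (rule G(2)[OF D(3)[OF that]])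
    show "l (G (F y)) = l y" using line[OF that] line[of "G (F y)"] eq that by simp
  qed
  obtain y0 where y0: "y0 \<in> V" "off_divisor z0 = \<psi> y0" using dom chart by auto
  have "blowup_proj \<phi> (\<psi> y0) = \<phi> (F y0)"
    unfolding \<psi>_def by (rule blowup_proj_class(2)[OF loc mem[OF y0(1)]])
  then have "\<phi> z0 = \<phi> (F y0)" using proj_off_divisor[OF z0] y0 by simp
  then have z0F: "z0 = F y0" using local_chart(3) z0 y0(1) by (auto simp: V_def dest: inj_onD)
  define S where "S = U \<inter> D"
  have S: "open S" "z0 \<in> S" using D z0 z0F local_chart by (auto simp: S_def)
  have memS: "off_divisor z \<in> \<psi> ` V" "coord (chart_of_param V \<psi>) (off_divisor z) = G z" if "z \<in> S" for z
  proof -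
    have z: "F (G z) = z" "z \<in> U" "z \<noteq> 0" using that G(2) D(2) by (auto simp: S_def)
    then have v: "G z \<in> V" by (simp add: V_def)
    have "off_divisor z = \<psi> (G z)" using off[OF v] z by simp
    then show "off_divisor z \<in> \<psi> ` V" "coord (chart_of_param V \<psi>) (off_divisor z) = G z"
      using v chart(2)[OF v] by auto
  qed
  have ev: "\<forall>\<^sub>F z in nhds z0. z \<in> S" by (rule eventually_nhds_in_open[OF S])
  obtain G' where "(G has_derivative G') (at z0)"
    using G(1) S(2) unfolding S_def differentiable_def by blast
  then have der: "((\<lambda>z. coord (chart_of_param V \<psi>) (off_divisor z)) has_derivative G') (at z0)"
    by (rule has_derivative_transform_within_open[OF _ S]) (simp add: memS)
  have Gz0: "G z0 = y0" using GF[of y0] z0F z0 by simp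
  have "isCont F y0" using F differentiable_imp_continuous_within by blast
  then have "filterlim F (nhds z0) (nhds y0)"
    using z0F by (metis isCont_def tendsto_at_iff_tendsto_nhds)
  then have "\<forall>\<^sub>F y in nhds y0. F y \<in> S" using ev unfolding filterlim_iff by blast
  then have evF: "\<forall>\<^sub>F y in nhds y0. y \<in> coord (chart_of_param V \<psi>) ` \<psi> ` V \<and>
      inv_coord (chart_of_param V \<psi>) y = off_divisor (F y)"
  proof eventually_elim
    case (elim y)
    then have y: "y \<in> V" "F y \<noteq> 0" using D(2) by (auto simp: V_def S_def)
    then show ?case using chart(2)[OF y(1)] chart(4)[OF y(1)] off[OF y] by (metis image_eqI)
  qed
  have evD: "\<forall>\<^sub>F z in nhds z0. off_divisor z \<in> \<psi> ` V"
    using ev by eventually_elim (rule memS)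
  have c0: "coord (chart_of_param V \<psi>) (off_divisor z0) = y0"
    using memS(2)[OF S(2)] Gz0 by simp
  have "\<exists>F. F differentiable (at y0) \<and> F y0 = z0 \<and> (\<forall>\<^sub>F y in nhds y0.
      y \<in> coord (chart_of_param V \<psi>) ` domain (chart_of_param V \<psi>) \<and>
      inv_coord (chart_of_param V \<psi>) y = off_divisor (F y))"
    unfolding chart(1) using evF F[of y0] z0F by (intro exI[of _ F]) simp
  then show "parametrized_at (chart_of_param V \<psi>) off_divisor z0"
    unfolding parametrized_at_def c0 unfolding chart(1)
    by (intro conjI chart(3) evD differentiableI[OF der])
qed

definition line_domain :: "C2 set" where "line_domain = {(a, u). (a, a * u) \<in> U}"

definition line_param :: "C2 \<Rightarrow> ('a + C2 \<times> C2 set) set" where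
  "line_param = (\<lambda>(a, u). blowup_class M x U \<phi> (Inr ((a, a * u), complex_line (1, u))))"

definition line_chart :: "(('a + C2 \<times> C2 set) set, C2) chart" where
  "line_chart = chart_of_param line_domain line_param"

lemma complex_line_eqD:
  "complex_line (1, u) = complex_line (1, u') \<Longrightarrow> u = u'"
  "complex_line (u, 1) = complex_line (u', 1) \<Longrightarrow> u = u'"
proof -
  assume "complex_line (1, u) = complex_line (1, u')"
  moreover have "(1, u) \<in> complex_line (1, u)"
    unfolding complex_line_def by (rule range_eqI[of _ _ 1]) simp
  ultimately have "(1, u) \<in> complex_line (1, u')" by simp
  then show "u = u'" by (auto simp: complex_line_def)
next
  assume "complex_line (u, 1) = complex_line (u', 1)"
  moreover have "(u, 1) \<in> complex_line (u, 1)"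
    unfolding complex_line_def by (rule range_eqI[of _ _ 1]) simp
  ultimately have "(u, 1) \<in> complex_line (u', 1)" by simp
  then show "u = u'" by (auto simp: complex_line_def)
qed

lemma line_param_eq: "line_param y = blowup_class M x U \<phi> (Inr ((fst y, fst y * snd y), complex_line (1, snd y)))"
  by (simp add: line_param_def case_prod_beta)

lemma inj_line_param: "inj_on line_param line_domain"
proof (rule inj_onI)
  fix y y' assume y: "y \<in> line_domain" and eq: "line_param y = line_param y'"
  have "((fst y, fst y * snd y), complex_line (1, snd y)) \<in> local_blowup U"
    using y by (auto simp: line_domain_def local_blowup_alt)
  from blowup_class_Inr_inj[OF this eq[unfolded line_param_eq]] show "y = y'"
    by (auto simp: prod_eq_iff dest: complex_line_eqD)
qed

lemma open_line_domain: "open line_domain"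
proof -
  have "line_domain = (\<lambda>y. (fst y, fst y * snd y)) -` U" by (auto simp: line_domain_def)
  then show ?thesis using local_chart(1) by (auto intro!: open_vimage continuous_intros)
qed

lemma line_chart_parametrized:
  assumes "z0 \<in> U" "z0 \<noteq> 0" "off_divisor z0 \<in> domain line_chart"
  shows "parametrized_at line_chart off_divisor z0"
proof -
  let ?F = "\<lambda>y::C2. (fst y, fst y * snd y)" and ?l = "\<lambda>y::C2. complex_line (1, snd y)"
  have V: "line_domain = {y. ?F y \<in> U}" by (auto simp: line_domain_def)
  have \<psi>: "line_param = (\<lambda>y. blowup_class M x U \<phi> (Inr (?F y, ?l y)))"
    by (simp add: line_param_eq fun_eq_iff)
  show ?thesis
    unfolding line_chart_def V \<psi>
  proof (rule standard_chart_parametrized[where D = "{z. fst z \<noteq> 0}" and G = "\<lambda>z. (fst z, snd z / fst z)"])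
    show "(?F y, ?l y) \<in> local_blowup U" if "y \<in> {y. ?F y \<in> U}" for y
      using that by (auto simp: local_blowup_alt)
    show "?l y = complex_line (?F y)" if "?F y \<noteq> 0" for y
      using complex_line_scale[of "fst y" 1 "snd y"] that by (auto simp: zero_prod_def)
    show "y = y'" if "?F y = ?F y'" "?l y = ?l y'" for y y'
      using that by (auto simp: prod_eq_iff dest: complex_line_eqD)
    show "open {z::C2. fst z \<noteq> 0}" by (intro open_Collect_neq continuous_intros)
    show "?F differentiable (at y)" for y
      by (rule differentiableI) (auto intro!: derivative_eq_intros)
    show "(\<lambda>z. (fst z, snd z / fst z)) differentiable (at z)" if "z \<in> {z::C2. fst z \<noteq> 0}" for z
      by (rule differentiableI) (use that in \<open>auto intro!: derivative_eq_intros\<close>)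
    show "off_divisor z0 \<in> domain (chart_of_param {y. ?F y \<in> U} (\<lambda>y. blowup_class M x U \<phi> (Inr (?F y, ?l y))))"
      using assms(3) by (simp only: line_chart_def V \<psi>)
  qed (use assms in \<open>auto simp: zero_prod_def\<close>)
qed

lemma second_line_chart_parametrized:
  assumes "z0 \<in> U" "z0 \<noteq> 0"
    and c: "c = chart_of_param {(u, b). (u * b, b) \<in> U}
        (\<lambda>(u, b). blowup_class M x U \<phi> (Inr ((u * b, b), complex_line (u, 1))))"
    and "off_divisor z0 \<in> domain c"
  shows "parametrized_at c off_divisor z0"
proof -
  let ?F = "\<lambda>y::C2. (fst y * snd y, snd y)" and ?l = "\<lambda>y::C2. complex_line (fst y, 1)"
  have c': "c = chart_of_param {y. ?F y \<in> U} (\<lambda>y. blowup_class M x U \<phi> (Inr (?F y, ?l y)))"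
    unfolding c by (simp add: case_prod_beta')
  show ?thesis
    unfolding c'
  proof (rule standard_chart_parametrized[where D = "{z. snd z \<noteq> 0}" and G = "\<lambda>z. (fst z / snd z, snd z)"])
    show "(?F y, ?l y) \<in> local_blowup U" if "y \<in> {y. ?F y \<in> U}" for y
      using that by (auto simp: local_blowup_alt)
    show "?l y = complex_line (?F y)" if "?F y \<noteq> 0" for y
      using complex_line_scale[of "snd y" "fst y" 1] that by (auto simp: zero_prod_def mult.commute)
    show "y = y'" if "?F y = ?F y'" "?l y = ?l y'" for y y'
      using that by (auto simp: prod_eq_iff dest: complex_line_eqD)
    show "open {z::C2. snd z \<noteq> 0}" by (intro open_Collect_neq continuous_intros)
    show "?F differentiable (at y)" for y
      by (rule differentiableI) (auto intro!: derivative_eq_intros)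
    show "(\<lambda>z. (fst z / snd z, snd z)) differentiable (at z)" if "z \<in> {z::C2. snd z \<noteq> 0}" for z
      by (rule differentiableI) (use that in \<open>auto intro!: derivative_eq_intros\<close>)
    show "off_divisor z0 \<in> domain (chart_of_param {y. ?F y \<in> U} (\<lambda>y. blowup_class M x U \<phi> (Inr (?F y, ?l y))))"
      using assms(4) by (simp only: c')
  qed (use assms in \<open>auto simp: zero_prod_def\<close>)
qed

lemma line_chart_in_blowup_atlas: "line_chart \<in> blowup_atlas M x U \<phi>"
  by (simp add: blowup_atlas_def line_chart_def line_domain_def line_param_def)

lemma blowup_atlas_compatible_off_divisor:
  assumes "z0 \<in> U" "z0 \<noteq> 0"
  shows "compatible_at (blowup_atlas M x U \<phi>) (off_divisor z0)"
proof (rule compatible_at_if_parametrized)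
  fix c assume "c \<in> charts_at (blowup_atlas M x U \<phi>) (off_divisor z0)"
  then have c: "c \<in> blowup_atlas M x U \<phi>" and dom: "off_divisor z0 \<in> domain c"
    by (auto simp: charts_at_def)
  from c consider k where "k \<in> M" "c = Chart ((\<lambda>y. blowup_class M x U \<phi> (Inl y)) ` (domain k - {x}))
          (\<lambda>q. coord k (blowup_proj \<phi> q))"
    | "c = line_chart"
    | "c = chart_of_param {(u, b). (u * b, b) \<in> U}
        (\<lambda>(u, b). blowup_class M x U \<phi> (Inr ((u * b, b), complex_line (u, 1))))"
    unfolding blowup_atlas_def line_chart_def line_domain_def line_param_def by blast
  then show "parametrized_at c off_divisor z0"
  proof cases
    case 1
    then show ?thesis using restricted_chart_parametrized[OF _ assms _ dom] by blast
  next
    case 2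
    then show ?thesis using line_chart_parametrized[OF assms] dom by simp
  next
    case 3
    then show ?thesis using second_line_chart_parametrized[OF assms _ dom] by blast
  qed
qed

lemma line_param_off_divisor:
  assumes "(a, u) \<in> line_domain" "a \<noteq> 0"
  shows "line_param (a, u) = off_divisor (a, a * u)"
  using assms off_divisor_eq[of "(a, a * u)"] complex_line_scale[of a 1 u]
  by (simp add: line_domain_def line_param_eq zero_prod_def)

end

section \<open>The almost complex structure in the parametrization\<close>

text \<open>The chart \<open>k\<close> of the atlas in which the Nijenhuis tensor is evaluated is fixed. The parametrization \<open>\<phi>\<close> need not
belong to the atlas, so \<open>J\<close> and vector fields are transported from \<open>k\<close> to \<open>U\<close> by the
differential of the coordinate change.\<close>

locale almost_complex_blowup = blowup_setting M x U \<phi>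
  for M :: "('a, C2) chart set" and x U \<phi> +
  fixes J :: "'a \<Rightarrow> ('a, C2) tvec \<Rightarrow> ('a, C2) tvec"
    and J' :: "('a + C2 \<times> C2 set) set \<Rightarrow> (('a + C2 \<times> C2 set) set, C2) tvec \<Rightarrow> (('a + C2 \<times> C2 set) set, C2) tvec"
    and k :: "('a, C2) chart"
  assumes acs: "almost_complex_structure M J"
    and blowup: "almost_complex_blowup_wrt M J x U \<phi> J'"
    and k: "k \<in> charts_at M x"
begin

abbreviation "\<theta> \<equiv> from_param k"
abbreviation "P \<equiv> param_domain k"
abbreviation "Jk \<equiv> end_component M J k"

definition D\<theta> :: "C2 \<Rightarrow> C2 \<Rightarrow> C2" where
  "D\<theta> z = frechet_derivative \<theta> (at z)"

text \<open>The differential of the inverse coordinate change at \<open>\<theta> z\<close>; the index is the point \<open>z\<close> of the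
parameter domain so that \<open>D\<psi> z\<close> is inverse to \<open>D\<theta> z\<close>.\<close>
definition D\<psi> :: "C2 \<Rightarrow> C2 \<Rightarrow> C2" where
  "D\<psi> z = frechet_derivative (to_param k) (at (\<theta> z))"

definition pulled_J :: "C2 \<Rightarrow> C2 \<Rightarrow> C2" where
  "pulled_J z e = D\<psi> z (Jk (\<theta> z) (D\<theta> z e))"

definition pulled_field :: "('a \<Rightarrow> ('a, C2) tvec) \<Rightarrow> C2 \<Rightarrow> C2" where
  "pulled_field X z = D\<psi> z (X (\<phi> z) k)"

lemma kM: "k \<in> M" and xk: "x \<in> domain k"
  using k by (auto simp: charts_at_def)

lemma open_P_0: "open P" "0 \<in> P"
  using open_param_domain[OF kM] local_chart(2,5) xk by (auto simp: param_domain_def)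

lemma \<theta>0: "\<theta> 0 = coord k x"
  using local_chart(5) by (simp add: from_param_def)

lemma \<theta>_in_chart: "z \<in> P \<Longrightarrow> \<theta> z \<in> coord k ` domain k"
  by (auto simp: from_param_def param_domain_def)

lemma \<theta>_has_derivative: "z \<in> P \<Longrightarrow> (\<theta> has_derivative D\<theta> z) (at z)"
  unfolding D\<theta>_def by (rule from_param_has_derivative[OF kM])

lemma \<psi>_has_derivative: "z \<in> P \<Longrightarrow> (to_param k has_derivative D\<psi> z) (at (\<theta> z))"
  unfolding D\<psi>_def by (rule to_param_has_derivative[OF kM])

lemma linear_D\<theta>: "z \<in> P \<Longrightarrow> linear (D\<theta> z)" and linear_D\<psi>: "z \<in> P \<Longrightarrow> linear (D\<psi> z)"
  using \<theta>_has_derivative \<psi>_has_derivative has_derivative_linear by blast+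

lemma D\<psi>_D\<theta>:
  assumes z: "z \<in> P"
  shows "D\<psi> z (D\<theta> z e) = e"
proof -
  have "((\<lambda>z. to_param k (\<theta> z)) has_derivative (\<lambda>e. D\<psi> z (D\<theta> z e))) (at z)"
    by (rule has_derivative_compose[OF \<theta>_has_derivative[OF z] \<psi>_has_derivative[OF z]])
  then have "((\<lambda>z. z) has_derivative (\<lambda>e. D\<psi> z (D\<theta> z e))) (at z)"
    by (rule has_derivative_transform_within_open[OF _ open_P_0(1) z]) (rule to_param_from_param(1)[OF kM])
  from has_derivative_unique[OF this has_derivative_ident] show ?thesis by (rule fun_cong)
qed

lemma D\<theta>_D\<psi>:
  assumes z: "z \<in> P"
  shows "D\<theta> z (D\<psi> z e) = e"
proof -
  have tz: "to_param k (\<theta> z) = z" by (rule to_param_from_param(1)[OF kM z])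
  have d: "(\<theta> has_derivative D\<theta> z) (at (to_param k (\<theta> z)))" unfolding tz by (rule \<theta>_has_derivative[OF z])
  have "((\<lambda>y. \<theta> (to_param k y)) has_derivative (\<lambda>e. D\<theta> z (D\<psi> z e))) (at (\<theta> z))"
    by (rule has_derivative_compose[OF \<psi>_has_derivative[OF z] d])
  then have "((\<lambda>y. y) has_derivative (\<lambda>e. D\<theta> z (D\<psi> z e))) (at (\<theta> z))"
    by (rule has_derivative_transform_within_open[OF _ open_from_param_image[OF kM]])
      (use z to_param_from_param(1)[OF kM] in auto)
  from has_derivative_unique[OF this has_derivative_ident] show ?thesis by (rule fun_cong)
qed

lemma linear_Jk: "z \<in> P \<Longrightarrow> linear (Jk (\<theta> z))"
  and Jk_square: "z \<in> P \<Longrightarrow> Jk (\<theta> z) (Jk (\<theta> z) e) = - e"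
  using end_component_on_chart[OF atlas acs kM \<theta>_in_chart] by blast+

lemma linear_pulled_J: "z \<in> P \<Longrightarrow> linear (pulled_J z)"
  using linear_compose[OF linear_compose[OF linear_D\<theta> linear_Jk] linear_D\<psi>]
  by (simp add: pulled_J_def[abs_def] o_def)

lemma pulled_J_square: "z \<in> P \<Longrightarrow> pulled_J z (pulled_J z e) = - e"
  by (simp add: pulled_J_def D\<theta>_D\<psi> Jk_square linear_neg[OF linear_D\<psi>] D\<psi>_D\<theta>)

lemma eventually_P: "\<forall>\<^sub>F z in nhds 0. z \<in> P"
  by (rule eventually_nhds_in_open[OF open_P_0])

lemma differentiable_apply_family:
  fixes A :: "C2 \<Rightarrow> C2 \<Rightarrow> C2" and b :: "C2 \<Rightarrow> C2"
  assumes "\<And>z. z \<in> P \<Longrightarrow> linear (A z)" "\<And>e. (\<lambda>z. A z e) differentiable (at 0)"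
    and "b differentiable (at 0)"
  shows "(\<lambda>z. A z (b z)) differentiable (at 0)"
proof -
  have lin: "\<forall>\<^sub>F z in nhds 0. linear (A z)"
    using eventually_P by eventually_elim (rule assms(1))
  have A': "((\<lambda>z. A z e) has_derivative (\<lambda>h. frechet_derivative (\<lambda>z. A z e) (at 0) h)) (at 0)" for e
    using assms(2)[of e] by (simp add: frechet_derivative_works[symmetric])
  obtain b' where "(b has_derivative b') (at 0)" using assms(3) unfolding differentiable_def by blast
  from has_derivative_linear_family_apply[OF lin A' this] show ?thesis by (rule differentiableI)
qed

lemma differentiable_compose_\<theta>:
  fixes f :: "C2 \<Rightarrow> C2"
  assumes "f differentiable (at (\<theta> 0))"
  shows "(\<lambda>z. f (\<theta> z)) differentiable (at 0)"
  using differentiable_chain_at[OF differentiableI[OF \<theta>_has_derivative[OF open_P_0(2)]] assms] by (simp add: o_def)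

lemma differentiable_D\<psi>: "(\<lambda>z. D\<psi> z e) differentiable (at 0)"
proof -
  have "(\<lambda>y. frechet_derivative (to_param k) (at y) e) differentiable (at (\<theta> 0))"
    by (rule smooth_on_differentiable[OF smooth_on_directional_derivative[OF smooth_to_param[OF kM]]])
      (use open_P_0 in auto)
  then show ?thesis unfolding D\<psi>_def by (rule differentiable_compose_\<theta>)
qed

lemma differentiable_pulled_J: "(\<lambda>z. pulled_J z e) differentiable (at 0)"
  unfolding pulled_J_def
proof (rule differentiable_apply_family[OF linear_D\<psi> differentiable_D\<psi>])
  show "(\<lambda>z. Jk (\<theta> z) (D\<theta> z e)) differentiable (at 0)"
  proof (rule differentiable_apply_family[OF linear_Jk])
    show "(\<lambda>z. Jk (\<theta> z) e) differentiable (at 0)" for e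
      by (rule differentiable_compose_\<theta>, rule smooth_on_differentiable[OF smooth_end_component[OF acs kM]])
        (rule \<theta>_in_chart[OF open_P_0(2)])
    show "(\<lambda>z. D\<theta> z e) differentiable (at 0)"
      using smooth_from_param[OF kM, of "Suc (Suc 0)"] open_P_0(2)
      by (simp add: D\<theta>_def del: split_paired_All)
  qed
qed

lemma line_chart_coords:
  assumes "y \<in> line_domain"
  shows "inv_coord line_chart y = line_param y" "coord line_chart (line_param y) = y"
    "line_param y \<in> domain line_chart"
  using assms inj_line_param inv_coord_chart_of_param[OF inj_line_param] coord_chart_of_param[OF inj_line_param]
  by (auto simp: line_chart_def)

lemma proj_line_param:
  assumes "y \<in> line_domain"
  shows "blowup_proj \<phi> (line_param y) = \<phi> (fst y, fst y * snd y)"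
  unfolding line_param_eq
  by (rule blowup_proj_class(2)[OF loc]) (use assms in \<open>auto simp: line_domain_def local_blowup_alt\<close>)

lemma coord_diff_proj:
  assumes y: "(a, u) \<in> line_domain" and z: "(a, a * u) \<in> P"
  shows "coord_diff line_chart k (blowup_proj \<phi>) (line_param (a, u)) e = D\<theta> (a, a * u) (blowdown_diff a u e)"
proof -
  have "((\<lambda>y::C2. (fst y, fst y * snd y)) has_derivative blowdown_diff a u) (at (a, u))"
    unfolding blowdown_diff_def by (auto intro!: derivative_eq_intros simp: mult.commute)
  then have "((\<lambda>y. \<theta> (fst y, fst y * snd y)) has_derivative (\<lambda>e. D\<theta> (a, a * u) (blowdown_diff a u e))) (at (a, u))"
    by (rule has_derivative_compose) (simp add: \<theta>_has_derivative[OF z])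
  then have "((\<lambda>y. coord k (blowup_proj \<phi> (inv_coord line_chart y))) has_derivative
      (\<lambda>e. D\<theta> (a, a * u) (blowdown_diff a u e))) (at (a, u))"
    by (rule has_derivative_transform_within_open[OF _ open_line_domain y])
      (simp add: line_chart_coords proj_line_param from_param_def)
  from fun_cong[OF frechet_derivative_at[OF this], of e] show ?thesis
    by (simp add: coord_diff_def line_chart_coords[OF y])
qed

text \<open>The pseudoholomorphy of the projection, written out in the chart \<open>(a, u)\<close> and in the parametrization. The
point lies off the exceptional divisor, where the chain rule for the atlas of the blow-up is available.\<close>

lemma pulled_J_lift:
  assumes z: "(a, a * u) \<in> P" and a: "a \<noteq> 0"
  shows "pulled_J (a, a * u) (blowdown_diff a u e) =
    blowdown_diff a u (end_component (blowup_atlas M x U \<phi>) J' line_chart (a, u) e)"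
proof -
  let ?A = "blowup_atlas M x U \<phi>" and ?p = "line_param (a, u)" and ?\<pi> = "blowup_proj \<phi>"
  have zU: "(a, a * u) \<in> U" and zk: "\<phi> (a, a * u) \<in> domain k" using z by (auto simp: param_domain_def)
  then have y: "(a, u) \<in> line_domain" by (simp add: line_domain_def)
  have acs': "almost_complex_structure ?A J'" and ph: "pseudoholomorphic ?A J' M J ?\<pi>"
    using blowup by (auto simp: almost_complex_blowup_wrt_def)
  have sm: "smooth_map ?A M ?\<pi>" using ph by (simp add: pseudoholomorphic_def)
  have p: "?p = off_divisor (a, a * u)" by (rule line_param_off_divisor[OF y a])
  have comp: "compatible_at ?A ?p"
    unfolding p by (rule blowup_atlas_compatible_off_divisor[OF zU]) (use a in \<open>simp add: zero_prod_def\<close>)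
  have c: "line_chart \<in> charts_at ?A ?p"
    using line_chart_in_blowup_atlas line_chart_coords(3)[OF y] by (simp add: charts_at_def)
  have pp: "?p \<in> points ?A" using c by (auto simp: charts_at_def points_def)
  have \<pi>p: "?\<pi> ?p = \<phi> (a, a * u)" using proj_line_param[OF y] by simp
  have kp: "k \<in> charts_at M (?\<pi> ?p)" using kM zk by (simp add: \<pi>p charts_at_def)
  have coordk: "coord k (?\<pi> ?p) = \<theta> (a, a * u)" by (simp add: \<pi>p from_param_def)
  define v where "v = tvec_of ?A line_chart ?p e"
  have v: "v \<in> tangent_space ?A ?p" unfolding v_def by (rule tvec_of_tangent[OF comp c])
  have J'v: "J' ?p v \<in> tangent_space ?A ?p" by (rule acs_tangent[OF acs' comp c v])
  have diff: "differential ?A M ?\<pi> ?p w k = D\<theta> (a, a * u) (blowdown_diff a u (w line_chart))"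
    if "w \<in> tangent_space ?A ?p" for w
    using differential_component[where f = "blowup_proj \<phi>", OF comp c that kp]
      smooth_map_differentiable[OF sm _ kp] coord_diff_proj[OF y z] by simp
  have "Jk (\<theta> (a, a * u)) (D\<theta> (a, a * u) (blowdown_diff a u e)) = J (?\<pi> ?p) (differential ?A M ?\<pi> ?p v) k"
    unfolding end_component_apply[OF smooth_atlas_compatible_at[OF atlas] kp
        differential_tangent[OF comp pp smooth_atlas_compatible_at[OF atlas] sm]] diff[OF v] coordk
    by (simp add: v_def tvec_of_component[OF comp c])
  also have "\<dots> = differential ?A M ?\<pi> ?p (J' ?p v) k"
    using ph pp v by (simp add: pseudoholomorphic_def)
  also have "\<dots> = D\<theta> (a, a * u) (blowdown_diff a u (J' ?p v line_chart))"
    by (rule diff[OF J'v])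
  also have "J' ?p v line_chart = end_component ?A J' line_chart (a, u) e"
    by (simp add: end_component_def line_chart_coords[OF y] v_def)
  finally show ?thesis by (simp add: pulled_J_def D\<psi>_D\<theta>[OF z])
qed

text \<open>The lift is the matrix of the structure on the blow-up in the chart \<open>(a, u)\<close>, applied to a fixed
vector. On the divisor \<open>a = 0\<close> it is the smoothness of this matrix that carries the information.\<close>

sublocale liftable_structure pulled_J "\<lambda>h e. frechet_derivative (\<lambda>z. pulled_J z e) (at 0) h"
proof
  show "\<forall>\<^sub>F z in nhds 0. linear (pulled_J z)"
    using eventually_P by eventually_elim (rule linear_pulled_J)
  show "\<forall>\<^sub>F z in nhds 0. \<forall>e. pulled_J z (pulled_J z e) = - e"
    using eventually_P by eventually_elim (rule allI, rule pulled_J_square)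
  show "((\<lambda>z. pulled_J z e) has_derivative (\<lambda>h. frechet_derivative (\<lambda>z. pulled_J z e) (at 0) h)) (at 0)" for e
    using differentiable_pulled_J[of e] by (simp add: frechet_derivative_works[symmetric])
  fix u e
  let ?A = "blowup_atlas M x U \<phi>"
  let ?K = "\<lambda>a. end_component ?A J' line_chart (a, u) e"
  have acs': "almost_complex_structure ?A J'"
    using blowup by (simp add: almost_complex_blowup_wrt_def)
  have y0: "(0, u) \<in> line_domain" using local_chart(2) by (simp add: line_domain_def zero_prod_def)
  have "(0, u) \<in> coord line_chart ` domain line_chart"
    using line_chart_coords[OF y0] by (metis image_eqI)
  then have "(\<lambda>y. end_component ?A J' line_chart y e) differentiable (at (0, u))"
    by (rule smooth_on_differentiable[OF smooth_end_component[OF acs' line_chart_in_blowup_atlas]])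
  moreover have "(\<lambda>a. (a, u)) differentiable (at (0::complex))"
    by (rule differentiableI) (auto intro!: derivative_eq_intros)
  ultimately have "?K differentiable (at 0)"
    using differentiable_chain_at[of "\<lambda>a. (a, u)" 0 "\<lambda>y. end_component ?A J' line_chart y e"]
    by (simp add: o_def)
  moreover have "\<forall>\<^sub>F a in at 0. pulled_J (a, a * u) (blowdown_diff a u e) = blowdown_diff a u (?K a)"
  proof -
    have "((\<lambda>a. (a, a * u)) \<longlongrightarrow> 0) (at 0)" by (auto intro!: tendsto_eq_intros simp: zero_prod_def)
    then have "\<forall>\<^sub>F a in at 0. (a, a * u) \<in> P" by (rule topological_tendstoD[OF _ open_P_0])
    moreover have "\<forall>\<^sub>F a in at 0. a \<noteq> (0::complex)" by (simp add: eventually_at_filter)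
    ultimately show ?thesis by eventually_elim (rule pulled_J_lift)
  qed
  ultimately show "\<exists>K. K differentiable (at 0) \<and>
      (\<forall>\<^sub>F a in at 0. pulled_J (a, a * u) (blowdown_diff a u e) = blowdown_diff a u (K a))" by blast
qed

lemma pulled_field_eq:
  assumes "z \<in> P"
  shows "pulled_field X z = D\<psi> z (X (inv_coord k (\<theta> z)) k)"
  by (simp add: pulled_field_def to_param_from_param(2)[OF kM assms])

lemma pulled_field_differentiable:
  assumes X: "differentiable_field M X"
  shows "pulled_field X differentiable (at 0)"
proof -
  have "(\<lambda>y. X (inv_coord k y) k) differentiable (at (\<theta> 0))"
    using X kM \<theta>_in_chart[OF open_P_0(2)] unfolding differentiable_field_def by blast
  then have "(\<lambda>z. D\<psi> z (X (inv_coord k (\<theta> z)) k)) differentiable (at 0)"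
    by (intro differentiable_apply_family[OF linear_D\<psi> differentiable_D\<psi>] differentiable_compose_\<theta>)
  then obtain D where "((\<lambda>z. D\<psi> z (X (inv_coord k (\<theta> z)) k)) has_derivative D) (at 0)"
    unfolding differentiable_def by blast
  then have "(pulled_field X has_derivative D) (at 0)"
    by (rule has_derivative_transform_within_open[OF _ open_P_0]) (rule pulled_field_eq[symmetric])
  then show ?thesis by (rule differentiableI)
qed

lemma pulled_acs_field:
  assumes X: "differentiable_field M X" and z: "z \<in> P"
  shows "pulled_field (\<lambda>q. J q (X q)) z = pulled_J z (pulled_field X z)"
  unfolding pulled_field_eq[OF z] pulled_J_def D\<theta>_D\<psi>[OF z]
    acs_field_component[OF atlas X kM \<theta>_in_chart[OF z]] ..

lemma pulled_bracket:
  assumes X: "differentiable_field M X" and Y: "differentiable_field M Y"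
  shows "local_bracket (pulled_field X) (pulled_field Y) 0 = D\<psi> 0 (lie_bracket M X Y x k)"
proof -
  have t0: "to_param k (\<theta> 0) = 0" by (rule to_param_from_param(1)[OF kM open_P_0(2)])
  have S: "open (\<theta> ` P)" "\<theta> 0 \<in> \<theta> ` P" using open_from_param_image[OF kM] open_P_0 by auto
  have rel: "\<forall>\<^sub>F y in nhds (\<theta> 0). pulled_field Z (to_param k y) =
      frechet_derivative (to_param k) (at y) (Z (inv_coord k y) k)" for Z
    using eventually_nhds_in_open[OF S]
  proof eventually_elim
    case (elim y)
    then obtain z where z: "z \<in> P" "y = \<theta> z" by blast
    show ?case
      unfolding z(2) to_param_from_param(1)[OF kM z(1)] pulled_field_eq[OF z(1)] D\<psi>_def ..
  qed
  have dif: "(\<lambda>y. Z (inv_coord k y) k) differentiable (at (\<theta> 0))" if "differentiable_field M Z" for Z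
    using that kM \<theta>_in_chart[OF open_P_0(2)] unfolding differentiable_field_def by blast
  have "local_bracket (pulled_field X) (pulled_field Y) (to_param k (\<theta> 0)) =
      frechet_derivative (to_param k) (at (\<theta> 0))
        (local_bracket (\<lambda>y. X (inv_coord k y) k) (\<lambda>y. Y (inv_coord k y) k) (\<theta> 0))"
  proof (rule bracket_of_related_fields[OF _ S dif[OF X] dif[OF Y]])
    show "Ck_on (Suc (Suc 0)) (to_param k) (\<theta> ` P)"
      using smooth_to_param[OF kM] unfolding smooth_on_def by blast
  qed (simp_all add: t0 pulled_field_differentiable X Y rel)
  then show ?thesis
    by (simp add: t0 D\<psi>_def lie_bracket_component[OF smooth_atlas_compatible_at[OF atlas] k] flip: \<theta>0)
qed

text \<open>The differential \<open>D\<psi> 0\<close> is injective and intertwines \<open>J\<close> with its transport, so the vanishing in the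
parametrization gives the vanishing in the chart \<open>k\<close>.\<close>

lemma nijenhuis_component_zero:
  assumes "smooth_vector_field M X" "smooth_vector_field M Y"
  shows "nijenhuis M J X Y x k = 0"
proof -
  have X: "differentiable_field M X" and Y: "differentiable_field M Y"
    using assms smooth_vector_field_differentiable by blast+
  define JX JY where "JX = (\<lambda>q. J q (X q))" and "JY = (\<lambda>q. J q (Y q))"
  have JX: "differentiable_field M JX" and JY: "differentiable_field M JY"
    unfolding JX_def JY_def using acs_field_differentiable[OF atlas acs] X Y by blast+
  note d = pulled_field_differentiable
  define br where "br V W = lie_bracket M V W x k" for V W
  have pJX: "pulled_field JX z = pulled_J z (pulled_field X z)"
    and pJY: "pulled_field JY z = pulled_J z (pulled_field Y z)" if "z \<in> P" for z
    unfolding JX_def JY_def using pulled_acs_field that X Y by blast+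
  have 1: "local_bracket (\<lambda>z. pulled_J z (pulled_field X z)) (\<lambda>z. pulled_J z (pulled_field Y z)) 0 = D\<psi> 0 (br JX JY)"
    unfolding br_def pulled_bracket[OF JX JY, symmetric]
    by (rule local_bracket_cong[OF d[OF JX] d[OF JY] open_P_0 pJX pJY, symmetric])
  have 2: "local_bracket (\<lambda>z. pulled_J z (pulled_field X z)) (pulled_field Y) 0 = D\<psi> 0 (br JX Y)"
    unfolding br_def pulled_bracket[OF JX Y, symmetric]
    by (rule local_bracket_cong[OF d[OF JX] d[OF Y] open_P_0 pJX refl, symmetric])
  have 3: "local_bracket (pulled_field X) (\<lambda>z. pulled_J z (pulled_field Y z)) 0 = D\<psi> 0 (br X JY)"
    unfolding br_def pulled_bracket[OF X JY, symmetric]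
    by (rule local_bracket_cong[OF d[OF X] d[OF JY] open_P_0 refl pJY, symmetric])
  have 4: "local_bracket (pulled_field X) (pulled_field Y) 0 = D\<psi> 0 (br X Y)"
    unfolding br_def by (rule pulled_bracket[OF X Y])
  have J0: "pulled_J 0 (D\<psi> 0 w) = D\<psi> 0 (Jk (\<theta> 0) w)" for w
    by (simp add: pulled_J_def D\<theta>_D\<psi>[OF open_P_0(2)])
  define N where "N = br JX JY - br X Y - Jk (\<theta> 0) (br JX Y) - Jk (\<theta> 0) (br X JY)"
  have "D\<psi> 0 N = 0"
    using local_nijenhuis_zero[OF d[OF X] d[OF Y], unfolded 1 2 3 4 J0]
    unfolding N_def linear_diff[OF linear_D\<psi>[OF open_P_0(2)]] .
  then have "N = 0" using D\<theta>_D\<psi>[OF open_P_0(2), of N] linear_0[OF linear_D\<theta>[OF open_P_0(2)]] by simp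
  have "J x (lie_bracket M V W x) k = Jk (\<theta> 0) (br V W)"
    if "differentiable_field M V" "differentiable_field M W" for V W
    unfolding br_def \<theta>0
    by (rule end_component_apply[OF smooth_atlas_compatible_at[OF atlas] k lie_bracket_tangent[OF atlas that]])
  then have "nijenhuis M J X Y x k = N"
    using X Y JX JY by (simp add: nijenhuis_def Let_def N_def br_def flip: JX_def JY_def)
  then show ?thesis using \<open>N = 0\<close> by simp
qed

end

theorem theorem2p12:
  fixes M :: "('a, complex \<times> complex) chart set"
    and J :: "'a \<Rightarrow> ('a, complex \<times> complex) tvec \<Rightarrow> ('a, complex \<times> complex) tvec"
    and x :: 'a
  assumes "smooth_manifold M"
    and "almost_complex_structure M J"
    and "x \<in> points M"
    and "has_almost_complex_blowup M J x"
  shows "\<forall>X Y. smooth_vector_field M X \<and> smooth_vector_field M Y \<longrightarrow>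
           nijenhuis M J X Y x = (\<lambda>k. 0)"
proof (intro allI impI ext)
  fix X Y k
  assume XY: "smooth_vector_field M X \<and> smooth_vector_field M Y"
  have atlas: "smooth_atlas M" using assms(1) by (simp add: smooth_manifold_def)
  obtain U \<phi> J' where loc: "local_chart_at M x U \<phi>" and blowup: "almost_complex_blowup_wrt M J x U \<phi> J'"
    using assms(4) by (auto simp: has_almost_complex_blowup_def)
  show "nijenhuis M J X Y x k = 0"
  proof (cases "k \<in> charts_at M x")
    case True
    interpret almost_complex_blowup M x U \<phi> J J' k
      by unfold_locales (fact atlas loc assms(2) blowup True)+
    show ?thesis using nijenhuis_component_zero XY by blast
  next
    case False
    \<comment> \<open>At a chart that does not contain \<open>x\<close> every tangent vector has component 0, so tangency of all terms suffices.\<close>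
    obtain k' where k': "k' \<in> charts_at M x" using assms(3) by (auto simp: points_def charts_at_def)
    have X: "differentiable_field M X" and Y: "differentiable_field M Y"
      using XY smooth_vector_field_differentiable by blast+
    have JX: "differentiable_field M (\<lambda>q. J q (X q))" and JY: "differentiable_field M (\<lambda>q. J q (Y q))"
      using acs_field_differentiable[OF atlas assms(2)] X Y by blast+
    have "J x (lie_bracket M V W x) k = 0" if "differentiable_field M V" "differentiable_field M W" for V W
      using acs_tangent[OF assms(2) smooth_atlas_compatible_at[OF atlas] k' lie_bracket_tangent[OF atlas that]]
        False by (simp add: tangent_space_def)
    moreover have "lie_bracket M V W x k = 0" for V W using False by (simp add: lie_bracket_def)
    ultimately show ?thesis
      using X Y JX JY by (simp add: nijenhuis_def Let_def)
  qed
qed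

end
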